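(* The following map is a poset isomorphism from the faces of the braid arrangement in $\mathbb R^n$ (ordered by $F\le F'$ iff $F$ is contained in the closure of $F'$) to the blocks of $\tilde W\cup\tilde{\mathcal W}$ (ordered as in the context). - The lowest-dimensional face $\{x_1=\dots=x_n\}$ is sent to the block $\tilde W$. - Every other face $F$ is sent to the block containing $\mathrm{Inv}(t_\lambda^\infty)$, where $\lambda$ is any element of $Q^\vee\cap F$.
   Context: $\tilde W$ is the affine symmetric group (affine Weyl group of type $\tilde A_{n-1}$) with simple generators $s_i$ and simple roots $\alpha_i$, $i\in\mathbb Z/n\mathbb Z$. For $w$ with reduced word $i_1\cdots i_k$, $\mathrm{Inv}(w)=\{\alpha_{i_1},s_{i_1}\alpha_{i_2},\dots,s_{i_1}\cdots s_{i_{k-1}}\alpha_{i_k}\}$. An infinite word $\mathbf i$ in $\mathbb Z/n\mathbb Z$ is reduced if each prefix $s_{i_1}\cdots s_{i_k}$ has length $k$, and $\mathrm{Inv}(\mathbf i)$ is the union of the inversion sets of its prefixes. Braid-equivalence classes $[\mathbf i]$ (same inversion set) of infinite reduced words are limit elements; $\tilde{\mathcal W}$ is their set. $\tilde W\cup\tilde{\mathcal W}$ is partially ordered by inclusion of inversion sets. Blocks: two limit elements are in the same block if the symmetric difference of their inversion sets is finite. $\tilde W$ itself is also regarded as one block. Blocks are ordered by $B\le B'$ iff there exist $x\in B$, $y\in B'$ with $x\le y$. $Q^\vee=\{\lambda\in\mathbb Z^n:\sum\lambda_i=0\}$. The translation $t_\lambda\in\tilde W$ is the bijection $i\mapsto i+n\lambda_i$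 of $\mathbb Z$ (indices of $\lambda$ read mod $n$), in the realization of $\tilde W$ as bijections $w$ of $\mathbb Z$ with $w(i+n)=w(i)+n$. For $\lambda\ne0$, $t_\lambda^\infty$ denotes the infinite word obtained by repeating a reduced word of $t_\lambda$; it is reduced. The braid arrangement in $\mathbb R^n$ consists of the hyperplanes $x_i=x_j$, $i<j$. Its open faces correspond to total preorders on $[n]$. *)

theory Defs
  imports "HOL-Analysis.Analysis" "Berlekamp_Zassenhaus.Finite_Field"
begin

text \<open>
  Throughout, \<open>n = CARD('n)\<close> with \<open>n \<ge> 2\<close> (this is the class \<open>nontriv\<close>), and
  \<open>'n mod_ring\<close> is \<open>\<int>/n\<int>\<close>.  The coordinates of \<open>\<real>^n\<close> are indexed by \<open>\<int>/n\<int>\<close>, i.e. by the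
  representatives \<open>1, \<dots>, n\<close>; thus \<open>v $ of_int i\<close> is \<open>v\<^sub>i\<close> with the index read mod \<open>n\<close>.
\<close>


subsection \<open>The affine symmetric group\<close>

text \<open>The last condition is the usual normalisation of the window \<open>(w(1), \<dots>, w(n))\<close>; it excludes
  e.g. the shift \<open>i \<mapsto> i + 1\<close>, which is not in the Coxeter group generated by the \<open>s\<^sub>i\<close>.\<close>

definition affine_sym :: "'n::nontriv itself \<Rightarrow> (int \<Rightarrow> int) set" where
  "affine_sym _ = {w. bij w \<and> (\<forall>i. w (i + int CARD('n)) = w i + int CARD('n)) \<and>
     (\<Sum>i = 1..int CARD('n). w i) = (\<Sum>i = 1..int CARD('n). i)}"

text \<open>\<open>s\<^sub>i\<close> exchanges \<open>j\<close> and \<open>j + 1\<close> for all \<open>j \<equiv> i (mod n)\<close>.\<close>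

definition simple_gen :: "'n::nontriv mod_ring \<Rightarrow> int \<Rightarrow> int" where
  "simple_gen i j = (if of_int j = i then j + 1 else if of_int j = i + 1 then j - 1 else j)"

definition word_perm :: "'n::nontriv mod_ring list \<Rightarrow> int \<Rightarrow> int" where
  "word_perm u = foldr (\<lambda>i w. simple_gen i \<circ> w) u id"

definition affine_length :: "'n::nontriv itself \<Rightarrow> (int \<Rightarrow> int) \<Rightarrow> nat" where
  "affine_length _ w = (LEAST k. \<exists>u :: 'n mod_ring list. length u = k \<and> word_perm u = w)"

definition reduced_word :: "'n::nontriv mod_ring list \<Rightarrow> bool" where
  "reduced_word u \<longleftrightarrow> affine_length TYPE('n) (word_perm u) = length u"

definition translation :: "int ^ ('n::nontriv mod_ring) \<Rightarrow> int \<Rightarrow> int" where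
  "translation l i = i + int CARD('n) * l $ of_int i"


subsection \<open>Inversion sets\<close>

text \<open>The affine root lattice is \<open>\<int>^n\<close>, with basis the simple roots.\<close>

definition simple_root :: "'n::nontriv mod_ring \<Rightarrow> int ^ ('n mod_ring)" where
  "simple_root i = axis i 1"

text \<open>\<open>s\<^sub>i \<beta> = \<beta> - \<langle>\<beta>, \<alpha>\<^sub>i\<^sup>\<or>\<rangle> \<alpha>\<^sub>i\<close> for the affine Cartan matrix of type \<open>A\<close>.  For \<open>n = 2\<close> the
  residues \<open>i - 1\<close> and \<open>i + 1\<close> coincide, which yields the off-diagonal entries \<open>-2\<close>.\<close>

definition simple_refl :: "'n::nontriv mod_ring \<Rightarrow> int ^ ('n mod_ring) \<Rightarrow> int ^ ('n mod_ring)" where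
  "simple_refl i b = b - axis i (2 * b $ i - b $ (i - 1) - b $ (i + 1))"

definition word_inv :: "'n::nontriv mod_ring list \<Rightarrow> (int ^ ('n mod_ring)) set" where
  "word_inv u = (\<lambda>k. foldr simple_refl (take k u) (simple_root (u ! k))) ` {..<length u}"

text \<open>All reduced words of \<open>w\<close> have the same inversion set, so the union is over equal sets.\<close>

definition perm_inv :: "(int \<Rightarrow> int) \<Rightarrow> (int ^ ('n::nontriv mod_ring)) set" where
  "perm_inv w = (\<Union>u \<in> {u. reduced_word u \<and> word_perm u = w}. word_inv u)"


subsection \<open>Limit elements\<close>

definition prefix_word :: "nat \<Rightarrow> (nat \<Rightarrow> 'a) \<Rightarrow> 'a list" where
  "prefix_word k a = map a [0..<k]"

definition inf_reduced :: "(nat \<Rightarrow> 'n::nontriv mod_ring) \<Rightarrow> bool" where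
  "inf_reduced a \<longleftrightarrow> (\<forall>k. affine_length TYPE('n) (word_perm (prefix_word k a)) = k)"

definition inf_inv :: "(nat \<Rightarrow> 'n::nontriv mod_ring) \<Rightarrow> (int ^ ('n mod_ring)) set" where
  "inf_inv a = (\<Union>k. word_inv (prefix_word k a))"

definition braid_equiv :: "((nat \<Rightarrow> 'n::nontriv mod_ring) \<times> (nat \<Rightarrow> 'n mod_ring)) set" where
  "braid_equiv = {(a, b). inf_reduced a \<and> inf_reduced b \<and> inf_inv a = inf_inv b}"

definition braid_class :: "(nat \<Rightarrow> 'n::nontriv mod_ring) \<Rightarrow> (nat \<Rightarrow> 'n mod_ring) set" where
  "braid_class a = braid_equiv `` {a}"

definition limit_elements :: "(nat \<Rightarrow> 'n::nontriv mod_ring) set set" where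
  "limit_elements = Collect inf_reduced // braid_equiv"

text \<open>The infinite word \<open>u u u \<dots>\<close>, for \<open>u\<close> nonempty.\<close>

definition repeat_word :: "'a list \<Rightarrow> nat \<Rightarrow> 'a" where
  "repeat_word u k = u ! (k mod length u)"


subsection \<open>Blocks\<close>

text \<open>Elements of \<open>W \<union> \<W>\<close>: \<open>Inl w\<close> is an affine permutation, \<open>Inr c\<close> a limit element.\<close>

type_synonym 'n elt = "(int \<Rightarrow> int) + (nat \<Rightarrow> 'n mod_ring) set"

definition elt_inv :: "'n::nontriv elt \<Rightarrow> (int ^ ('n mod_ring)) set" where
  "elt_inv x = (case x of Inl w \<Rightarrow> perm_inv w | Inr c \<Rightarrow> (\<Union>a\<in>c. inf_inv a))"

definition elt_le :: "'n::nontriv elt \<Rightarrow> 'n elt \<Rightarrow> bool" where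
  "elt_le x y \<longleftrightarrow> elt_inv x \<subseteq> elt_inv y"

definition same_block :: "('n::nontriv elt \<times> 'n elt) set" where
  "same_block = {(x, y). x \<in> Inr ` limit_elements \<and> y \<in> Inr ` limit_elements \<and>
     finite ((elt_inv x - elt_inv y) \<union> (elt_inv y - elt_inv x))}"

definition group_block :: "'n::nontriv elt set" where
  "group_block = Inl ` affine_sym TYPE('n)"

definition blocks :: "'n::nontriv elt set set" where
  "blocks = insert group_block (Inr ` limit_elements // same_block)"

definition block_order :: "('n::nontriv elt set \<times> 'n elt set) set" where
  "block_order = {(B, B'). B \<in> blocks \<and> B' \<in> blocks \<and> (\<exists>x\<in>B. \<exists>y\<in>B'. elt_le x y)}"


subsection \<open>Faces of the braid arrangement\<close>

definition braid_face :: "real ^ ('n::nontriv mod_ring) \<Rightarrow> (real ^ ('n mod_ring)) set" where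
  "braid_face x = {y. \<forall>i j. sgn (y $ i - y $ j) = sgn (x $ i - x $ j)}"

definition braid_faces :: "(real ^ ('n::nontriv mod_ring)) set set" where
  "braid_faces = range braid_face"

definition face_order :: "((real ^ ('n::nontriv mod_ring)) set \<times> (real ^ ('n mod_ring)) set) set" where
  "face_order = {(F, F'). F \<in> braid_faces \<and> F' \<in> braid_faces \<and> F \<subseteq> closure F'}"

definition minimal_face :: "(real ^ ('n::nontriv mod_ring)) set" where
  "minimal_face = {x. \<forall>i j. x $ i = x $ j}"

text \<open>\<open>Q\<^sup>\<or> \<inter> F\<close>, as a set of integer vectors.\<close>

definition coroot_points :: "(real ^ ('n::nontriv mod_ring)) set \<Rightarrow> (int ^ ('n mod_ring)) set" where
  "coroot_points F = {l. (\<Sum>i\<in>UNIV. l $ i) = 0 \<and> (\<chi> i. real_of_int (l $ i)) \<in> F}"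


definition poset_isomorphism ::
    "'a set \<Rightarrow> ('a \<times> 'a) set \<Rightarrow> 'b set \<Rightarrow> ('b \<times> 'b) set \<Rightarrow> ('a \<Rightarrow> 'b) \<Rightarrow> bool" where
  "poset_isomorphism A r B s f \<longleftrightarrow>
     partial_order_on A r \<and> partial_order_on B s \<and> bij_betw f A B \<and>
     (\<forall>x\<in>A. \<forall>y\<in>A. (x, y) \<in> r \<longleftrightarrow> (f x, f y) \<in> s)"

end

theory Submission
  imports Defs
begin

text \<open>
  A word is reduced iff each letter makes an ascent of the preceding product, so the inversion set
  of a reduced word is \<open>{\<epsilon>\<^sub>a - \<epsilon>\<^sub>b | a < b, w\<^sup>-\<^sup>1 a > w\<^sup>-\<^sup>1 b}\<close>. Group the positive roots into the
  strings \<open>\<epsilon>\<^sub>c - \<epsilon>\<^sub>d\<close> with prescribed residues \<open>x\<close> of \<open>c\<close> and \<open>y\<close> of \<open>d\<close>: an inversion set meets each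
  string in an initial segment. For a limit element this segment is either finite or the whole
  string, so its block is determined by the set of pairs \<open>(x, y)\<close> with a full string. Comparing
  positions shows that this relation is a nonempty strict weak order, that is, a face other than the
  minimal one. For \<open>t\<^sub>\<lambda>\<^sup>\<infinity>\<close> the inversion set consists exactly of the full strings with
  \<open>\<lambda>\<^sub>x < \<lambda>\<^sub>y\<close>; hence every such face occurs, and inclusion of the relations is realised by inclusion
  of these inversion sets.
\<close>

section \<open>Residues and affine permutations\<close>

lemma residue_eq_iff:
  "(of_int a :: 'n::nontriv mod_ring) = of_int b \<longleftrightarrow> (\<exists>k. b = a + k * int CARD('n))"
proof -
  have "(of_int a :: 'n mod_ring) = of_int b \<longleftrightarrow> a mod int CARD('n) = b mod int CARD('n)"
    by transfer simp
  also have "\<dots> \<longleftrightarrow> (\<exists>k. b = a + k * int CARD('n))"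
    by (metis mod_eqE mod_mult_self1 mult.commute)
  finally show ?thesis .
qed

lemma residue_of_rep [simp]: "of_int (to_int_mod_ring i) = (i :: 'n::nontriv mod_ring)"
  by (simp add: of_int_of_int_mod_ring)

lemma card_gt_1: "int CARD('n::nontriv) > 1"
  using nontriv[where 'a = 'n] by simp

text \<open>Split off from \<open>affine_sym\<close> because ascents and inversions depend on these
  two conditions alone; the normalisation of the window enters in
  \<open>no_descent_id\<close>.\<close>

definition periodic_perm :: "'n::nontriv itself \<Rightarrow> (int \<Rightarrow> int) \<Rightarrow> bool" where
  "periodic_perm _ w \<longleftrightarrow> bij w \<and> (\<forall>i. w (i + int CARD('n)) = w i + int CARD('n))"

lemma periodic_perm_add_mult:
  assumes "periodic_perm TYPE('n::nontriv) w"
  shows "w (a + k * int CARD('n)) = w a + k * int CARD('n)"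
proof -
  have per: "w (i + int CARD('n)) = w i + int CARD('n)" for i
    using assms by (simp add: periodic_perm_def)
  show ?thesis
  proof (induction k rule: int_induct[where k = 0])
    case base
    show ?case by simp
  next
    case (step1 k)
    then show ?case
      using per[of "a + k * int CARD('n)"] by (simp add: algebra_simps)
  next
    case (step2 k)
    then show ?case
      using per[of "a + (k - 1) * int CARD('n)"] by (simp add: algebra_simps)
  qed
qed

lemma periodic_perm_eq_iff:
  assumes "periodic_perm TYPE('n::nontriv) w"
  shows "w a = w b \<longleftrightarrow> a = b"
  using assms by (auto simp: periodic_perm_def bij_def inj_def)

lemma periodic_perm_inv:
  assumes "periodic_perm TYPE('n::nontriv) w"
  shows "w (inv_into UNIV w a) = a" "inv_into UNIV w (w a) = a"
  using assms by (auto simp: periodic_perm_def bij_def surj_f_inv_f)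

lemma periodic_perm_residue_eq:
  assumes w: "periodic_perm TYPE('n::nontriv) w"
  shows "(of_int (w a) :: 'n mod_ring) = of_int (w b) \<longleftrightarrow> (of_int a :: 'n mod_ring) = of_int b"
proof -
  have "w b = w a + k * int CARD('n) \<longleftrightarrow> b = a + k * int CARD('n)" for k
    using periodic_perm_add_mult[OF w, of a k] periodic_perm_eq_iff[OF w] by metis
  then show ?thesis by (simp add: residue_eq_iff)
qed

lemma periodic_perm_comp:
  assumes "periodic_perm TYPE('n::nontriv) v" "periodic_perm TYPE('n) w"
  shows "periodic_perm TYPE('n) (v \<circ> w)"
  using assms by (simp add: periodic_perm_def bij_comp)

lemma periodic_perm_id: "periodic_perm TYPE('n::nontriv) id"
  by (simp add: periodic_perm_def)

lemma affine_sym_iff: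
  "w \<in> affine_sym TYPE('n::nontriv) \<longleftrightarrow>
     periodic_perm TYPE('n) w \<and> (\<Sum>i = 1..int CARD('n). w i - i) = 0"
  by (auto simp: affine_sym_def periodic_perm_def sum_subtractf)

lemma residue_bij: "bij_betw of_int {1..int CARD('n)} (UNIV :: 'n::nontriv mod_ring set)"
proof -
  have inj: "inj_on (of_int :: int \<Rightarrow> 'n mod_ring) {1..int CARD('n)}"
  proof (rule inj_onI)
    fix x y assume x: "x \<in> {1..int CARD('n)}" and y: "y \<in> {1..int CARD('n)}"
      and "(of_int x :: 'n mod_ring) = of_int y"
    then obtain k where k: "y = x + k * int CARD('n)" by (auto simp: residue_eq_iff)
    have "\<bar>k * int CARD('n)\<bar> < int CARD('n)" using x y k by auto
    then have "k = 0" by (simp add: abs_mult)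
    then show "x = y" using k by simp
  qed
  moreover have "of_int ` {1..int CARD('n)} = (UNIV :: 'n mod_ring set)"
    by (rule card_subset_eq) (simp_all add: card_image[OF inj])
  ultimately show ?thesis by (simp add: bij_betw_def)
qed

lemma sum_residues:
  "(\<Sum>i = 1..int CARD('n). f (of_int i)) = (\<Sum>x\<in>(UNIV :: 'n::nontriv mod_ring set). f x)"
  by (rule sum.reindex_bij_betw[OF residue_bij])

text \<open>Evaluates a periodic function at the chosen representative of a residue, which turns
  sums and maxima over windows into ones over a finite type.\<close>

lemma periodic_factor:
  fixes f :: "int \<Rightarrow> 'a"
  assumes "\<And>i k. f (i + k * int CARD('n)) = f i"
  shows "f (to_int_mod_ring (of_int i :: 'n::nontriv mod_ring)) = f i"
proof -
  have "(of_int i :: 'n mod_ring) = of_int (to_int_mod_ring (of_int i :: 'n mod_ring))" by simp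
  then obtain k where "to_int_mod_ring (of_int i :: 'n mod_ring) = i + k * int CARD('n)"
    unfolding residue_eq_iff by blast
  then show ?thesis using assms by metis
qed

section \<open>Simple generators and words\<close>

lemma simple_gen_involution [simp]: "simple_gen i (simple_gen i j) = j"
proof -
  have "(1 :: 'a mod_ring) \<noteq> 0" by simp
  then show ?thesis by (auto simp: simple_gen_def)
qed

lemma simple_gen_periodic:
  "simple_gen (i :: 'n::nontriv mod_ring) (j + int CARD('n)) = simple_gen i j + int CARD('n)"
  by (simp add: simple_gen_def)

lemma simple_gen_perm: "periodic_perm TYPE('n) (simple_gen (i :: 'n::nontriv mod_ring))"
  unfolding periodic_perm_def
  by (auto simp: simple_gen_periodic intro!: o_bij[where g = "simple_gen i"])

lemma simple_gen_left: "of_int a = i \<Longrightarrow> simple_gen i a = a + 1"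
  by (simp add: simple_gen_def)

lemma simple_gen_right: "of_int a = i \<Longrightarrow> simple_gen (i :: 'n::nontriv mod_ring) (a + 1) = a"
  by (auto simp: simple_gen_def)

lemma affine_sym_simple_gen:
  fixes i :: "'n::nontriv mod_ring"
  assumes w: "w \<in> affine_sym TYPE('n)"
  shows "w \<circ> simple_gen i \<in> affine_sym TYPE('n)"
proof -
  have per: "periodic_perm TYPE('n) w" and sum0: "(\<Sum>j = 1..int CARD('n). w j - j) = 0"
    using w by (auto simp: affine_sym_iff)
  let ?r = "\<lambda>x :: 'n mod_ring. to_int_mod_ring x"
  \<comment> \<open>\<open>f\<close> is the displacement of \<open>w\<close> as a function of the
    residue, \<open>\<sigma>\<close> the transposition that \<open>simple_gen i\<close> induces on
    residues, and \<open>e\<close> its own displacement. Permuting residues keeps the sum of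
    \<open>f\<close>, and \<open>e\<close> sums to zero.\<close>
  define f where "f x = w (?r x) - ?r x" for x
  define \<sigma> :: "'n mod_ring \<Rightarrow> 'n mod_ring"
    where "\<sigma> x = (if x = i then i + 1 else if x = i + 1 then i else x)" for x
  define e :: "'n mod_ring \<Rightarrow> int"
    where "e x = (if x = i then 1 else 0) - (if x = i + 1 then 1 else 0)" for x
  have f: "w j - j = f (of_int j)" for j
    unfolding f_def
    by (rule periodic_factor[symmetric, where f = "\<lambda>j. w j - j"])
       (simp add: periodic_perm_add_mult[OF per])
  have ne: "i + 1 \<noteq> i" by simp
  have "w (simple_gen i j) - j = f (\<sigma> (of_int j)) + e (of_int j)" for j
  proof -
    have "of_int (simple_gen i j) = \<sigma> (of_int j)"
      using ne by (auto simp: simple_gen_def \<sigma>_def)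
    moreover have "simple_gen i j - j = e (of_int j)"
      using ne by (auto simp: simple_gen_def e_def)
    ultimately show ?thesis using f[of "simple_gen i j"] by simp
  qed
  then have "(\<Sum>j = 1..int CARD('n). w (simple_gen i j) - j)
      = (\<Sum>x\<in>UNIV. f (\<sigma> x) + e x)"
    by (simp add: sum_residues[where f = "\<lambda>x. f (\<sigma> x) + e x"])
  also have "\<dots> = (\<Sum>x\<in>UNIV. f (\<sigma> x)) + (\<Sum>x\<in>UNIV. e x)"
    by (rule sum.distrib)
  also have "(\<Sum>x\<in>UNIV. e x) = 0"
    by (simp add: e_def sum_subtractf)
  also have "(\<Sum>x\<in>UNIV. f (\<sigma> x)) = (\<Sum>x\<in>UNIV. f x)"
  proof (rule sum.reindex_bij_betw)
    show "bij_betw \<sigma> UNIV UNIV"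
      using ne by (intro o_bij[where g = \<sigma>]) (auto simp: \<sigma>_def)
  qed
  also have "(\<Sum>x\<in>UNIV. f x) = 0"
    using sum0 by (simp add: f sum_residues)
  finally have "(\<Sum>j = 1..int CARD('n). w (simple_gen i j) - j) = 0" by simp
  then show ?thesis
    using periodic_perm_comp[OF per simple_gen_perm[of i]] by (simp add: affine_sym_iff)
qed

lemma word_perm_Nil [simp]: "word_perm [] = id"
  by (simp add: word_perm_def)

lemma word_perm_Cons: "word_perm (i # u) = simple_gen i \<circ> word_perm u"
  by (simp add: word_perm_def)

lemma word_perm_append: "word_perm (u @ v) = word_perm u \<circ> word_perm v"
  by (induction u) (simp_all add: word_perm_Cons o_assoc)

lemma word_perm_snoc: "word_perm (u @ [i]) = word_perm u \<circ> simple_gen i"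
  by (simp add: word_perm_append word_perm_Cons)

lemma word_perm_affine_sym: "word_perm (u :: 'n::nontriv mod_ring list) \<in> affine_sym TYPE('n)"
proof (induction u rule: rev_induct)
  case Nil
  show ?case unfolding word_perm_Nil affine_sym_iff using periodic_perm_id[where 'n = 'n] by force
next
  case (snoc i u)
  then show ?case unfolding word_perm_snoc by (rule affine_sym_simple_gen)
qed

lemma word_perm_perm: "periodic_perm TYPE('n) (word_perm (u :: 'n::nontriv mod_ring list))"
  using word_perm_affine_sym[of u] by (simp add: affine_sym_iff)


section \<open>Roots as differences\<close>

text \<open>\<open>root_pot b - root_pot a\<close> is \<open>\<alpha>\<^sub>a + \<dots> + \<alpha>\<^bsub>b-1\<^esub>\<close> for \<open>a \<le> b\<close>, so \<open>affine_root a b\<close> is the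
  class of \<open>\<epsilon>\<^sub>a - \<epsilon>\<^sub>b\<close>, on which affine permutations act by moving \<open>a\<close> and \<open>b\<close>.\<close>

definition root_pot :: "int \<Rightarrow> int ^ ('n::nontriv mod_ring)" where
  "root_pot a = (\<Sum>k\<in>{0..<a}. axis (of_int k) 1) - (\<Sum>k\<in>{a..<0}. axis (of_int k) 1)"

definition affine_root :: "int \<Rightarrow> int \<Rightarrow> int ^ ('n::nontriv mod_ring)" where
  "affine_root a b = root_pot b - root_pot a"

lemma root_pot_Suc: "root_pot (a + 1) = (root_pot a :: int ^ ('n::nontriv mod_ring)) + axis (of_int a) 1"
proof (cases "a \<ge> 0")
  case True
  then have "{0..<a + 1} = insert a {0..<a}" "{a + 1..<0} = {}" "{a..<0} = {}" by auto
  then show ?thesis by (simp add: root_pot_def)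
next
  case False
  then have "{a..<0} = insert a {a + 1..<0}" "{0..<a + 1} = {}" "{0..<a} = {}" by auto
  then show ?thesis by (simp add: root_pot_def)
qed

text \<open>Used to avoid a split at zero in facts on \<open>root_pot\<close>: a defect unchanged by
  every unit step is constant.\<close>

lemma int_step_const:
  fixes f :: "int \<Rightarrow> 'a"
  assumes "\<And>a. f (a + 1) = f a"
  shows "f a = f b"
proof -
  have "f a = f 0" for a
    by (induction a rule: int_induct[where k = 0]) (use assms in \<open>metis diff_add_cancel\<close>)+
  then show ?thesis by metis
qed

text \<open>The step of \<open>root_pot\<close> at \<open>a\<close> depends only on the residue of
  \<open>a\<close>, so a shift by a multiple of n changes \<open>root_pot\<close> by the same vector
  everywhere.\<close>

lemma root_shift:
  "affine_root (a + k * int CARD('n)) (b + k * int CARD('n)) = (affine_root a b :: int ^ ('n::nontriv mod_ring))"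
proof -
  let ?P = "root_pot :: int \<Rightarrow> int ^ ('n mod_ring)"
  have "?P (a + 1 + k * int CARD('n)) - ?P (a + 1) = ?P (a + k * int CARD('n)) - ?P a" for a
    using root_pot_Suc[of "a + k * int CARD('n)", where 'n = 'n] root_pot_Suc[of a, where 'n = 'n]
    by (simp add: algebra_simps)
  from int_step_const[where f = "\<lambda>a. ?P (a + k * int CARD('n)) - ?P a", OF this]
  have "?P (a + k * int CARD('n)) - ?P a = ?P (b + k * int CARD('n)) - ?P b" .
  then show ?thesis by (simp add: affine_root_def algebra_simps)
qed

lemma sum_axis: "(\<Sum>i\<in>UNIV. axis (j :: 'a::finite) (1::int) $ i) = 1"
  by (simp add: axis_def)

lemma root_height: "(\<Sum>i\<in>UNIV. (affine_root a b :: int ^ ('n::nontriv mod_ring)) $ i) = b - a"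
proof -
  let ?P = "root_pot :: int \<Rightarrow> int ^ ('n mod_ring)"
  have "(\<Sum>i\<in>UNIV. ?P (a + 1) $ i) - (a + 1) = (\<Sum>i\<in>UNIV. ?P a $ i) - a" for a
    by (simp add: root_pot_Suc sum.distrib sum_axis)
  from int_step_const[where f = "\<lambda>a. (\<Sum>i\<in>UNIV. ?P a $ i) - a", OF this]
  have "(\<Sum>i\<in>UNIV. ?P b $ i) - b = (\<Sum>i\<in>UNIV. ?P a $ i) - a" .
  then show ?thesis by (simp add: affine_root_def sum_subtractf)
qed

text \<open>Passing from \<open>a\<close> to \<open>a + 1\<close> raises the coordinate at the
  residue of \<open>a\<close>; in differences of cyclically adjacent coordinates these contributions
  telescope, leaving only the endpoint residues.\<close>

lemma root_slope:
  "(affine_root a b :: int ^ ('n::nontriv mod_ring)) $ i - affine_root a b $ (i - 1)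
     = (if of_int a = i then 1 else 0) - (if of_int b = i then 1 else 0)"
proof -
  let ?P = "root_pot :: int \<Rightarrow> int ^ ('n mod_ring)"
  let ?f = "\<lambda>a. ?P a $ i - ?P a $ (i - 1) + (if of_int a = i then 1 else 0)"
  have "?f (a + 1) = ?f a" for a
    unfolding root_pot_Suc by (auto simp: axis_def diff_eq_eq)
  from int_step_const[where f = ?f, OF this] have "?f b = ?f a" .
  then show ?thesis by (simp add: affine_root_def)
qed

text \<open>\<open>root_slope\<close> recovers the residue of the first endpoint and
  \<open>root_height\<close> the distance. With equal endpoint residues all slopes vanish and the
  root no longer remembers where it starts, hence the second assumption.\<close>

lemma root_eqD:
  assumes eq: "affine_root a b = (affine_root c d :: int ^ ('n::nontriv mod_ring))"
    and ne: "(of_int a :: 'n mod_ring) \<noteq> of_int b"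
  obtains k where "c = a + k * int CARD('n)" "d = b + k * int CARD('n)"
proof -
  have "(of_int c :: 'n mod_ring) = of_int a"
    using root_slope[of a b "of_int a :: 'n mod_ring"] root_slope[of c d "of_int a :: 'n mod_ring"]
      ne eq by (auto split: if_splits)
  moreover have "d - c = b - a"
    using root_height[of a b, where 'n = 'n] root_height[of c d, where 'n = 'n] eq by simp
  ultimately show ?thesis
    using that residue_eq_iff[of a c, where 'n = 'n] by (metis add_diff_eq add.commute diff_add_cancel)
qed

lemma simple_root_eq: "simple_root (of_int a) = (affine_root a (a + 1) :: int ^ ('n::nontriv mod_ring))"
  by (simp add: simple_root_def affine_root_def root_pot_Suc)

lemma simple_refl_diff: "simple_refl i (v - w) = simple_refl i v - simple_refl i w"
  by (simp add: simple_refl_def vec_eq_iff axis_def)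

lemma simple_refl_simple_root:
  fixes i :: "'n::nontriv mod_ring"
  shows "simple_refl i (simple_root (of_int a)) = affine_root (simple_gen i a) (simple_gen i (a + 1))"
proof -
  have ne: "i - 1 \<noteq> i" "i + 1 \<noteq> i" "i \<noteq> i + 1" by simp_all
  have suc: "root_pot (b + 1) - root_pot b = (axis (of_int b) 1 :: int ^ ('n mod_ring))" for b
    by (simp only: root_pot_Suc add_diff_cancel_left')
  have refl: "simple_refl i (simple_root c) = axis c 1 - axis i
      (2 * (if c = i then 1 else 0) - (if c = i - 1 then 1 else 0) - (if c = i + 1 then 1 else 0))" for c
    by (simp add: simple_refl_def simple_root_def axis_def eq_commute)
  have ax: "axis i 2 = axis i 1 + axis i (1::int)" "axis i (- 1) = - axis i (1::int)"
    "axis i (- 2) = - axis i 1 - axis i (1::int)" "axis i (0::int) = 0"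
    by (simp_all add: vec_eq_iff axis_def)
  \<comment> \<open>The case \<open>both\<close> is that of n = 2, where the two neighbours of
    \<open>i\<close> coincide and the reflection adds the simple root twice.\<close>
  consider (eq) "of_int a = i" | (both) "of_int a = i + 1" "of_int a = i - 1"
    | (right) "of_int a = i + 1" "of_int a \<noteq> i - 1"
    | (left) "of_int a \<noteq> i + 1" "of_int a = i - 1"
    | (far) "of_int a \<noteq> i" "of_int a \<noteq> i + 1" "of_int a \<noteq> i - 1" by blast
  then show ?thesis
  proof cases
    case eq
    have "simple_gen i a = a + 1" "simple_gen i (a + 1) = a"
      using eq by (simp_all add: simple_gen_left simple_gen_right)
    moreover have "simple_refl i (simple_root (of_int a)) = - axis i 1"
      unfolding refl using eq ne ax(1) by simp
    moreover have "affine_root (a + 1) a = - (axis i 1 :: int ^ ('n mod_ring))"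
      using suc[of a] eq minus_diff_eq unfolding affine_root_def by metis
    ultimately show ?thesis by simp
  next
    case both
    have "i - 1 = i + 1" using both by simp
    then have "simple_gen i a = a - 1" "simple_gen i (a + 1) = a + 2"
      using both ne by (auto simp: simple_gen_def)
    moreover have "simple_refl i (simple_root (of_int a)) = axis (of_int a) 1 + axis i 1 + axis i 1"
      unfolding refl using both ne ax(3) by simp
    moreover have "affine_root (a - 1) (a + 2)
        = (axis (of_int a) 1 + axis i 1 + axis i 1 :: int ^ ('n mod_ring))"
    proof -
      have "of_int (a - 1) = i" using both(1) by simp
      moreover have "of_int (a + 1) = i" using both(2) by simp
      ultimately show ?thesis
        using suc[of "a - 1"] suc[of a] suc[of "a + 1"] by (simp add: affine_root_def algebra_simps)
    qed
    ultimately show ?thesis by simp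
  next
    case right
    have "of_int a + 1 \<noteq> i" using right(2) by auto
    then have "simple_gen i a = a - 1" "simple_gen i (a + 1) = a + 1"
      using right ne by (auto simp: simple_gen_def)
    moreover have "simple_refl i (simple_root (of_int a)) = axis (of_int a) 1 + axis i 1"
      unfolding refl using right ne ax(2) by simp
    moreover have "affine_root (a - 1) (a + 1) = (axis (of_int a) 1 + axis i 1 :: int ^ ('n mod_ring))"
    proof -
      have "of_int (a - 1) = i" using right(1) by simp
      then show ?thesis
        using suc[of "a - 1"] suc[of a] by (simp add: affine_root_def algebra_simps)
    qed
    ultimately show ?thesis by simp
  next
    case left
    have "of_int a \<noteq> i" using left(2) ne(1) by metis
    then have "simple_gen i a = a" "simple_gen i (a + 1) = a + 2"
      using left by (auto simp: simple_gen_def)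
    moreover have "simple_refl i (simple_root (of_int a)) = axis (of_int a) 1 + axis i 1"
      unfolding refl using left \<open>of_int a \<noteq> i\<close> ax(2) by simp
    moreover have "affine_root a (a + 2) = (axis (of_int a) 1 + axis i 1 :: int ^ ('n mod_ring))"
    proof -
      have "of_int (a + 1) = i" using left(2) by simp
      then show ?thesis
        using suc[of "a + 1"] suc[of a] by (simp add: affine_root_def algebra_simps)
    qed
    ultimately show ?thesis by simp
  next
    case far
    have "of_int a + 1 \<noteq> i" using far(3) by auto
    then have "simple_gen i a = a" "simple_gen i (a + 1) = a + 1"
      using far by (auto simp: simple_gen_def)
    then show ?thesis
      unfolding refl using far ax(4) suc[of a] by (simp add: affine_root_def)
  qed
qed

text \<open>By \<open>simple_refl_simple_root\<close> the defect of equivariance on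
  \<open>root_pot\<close> is the same at \<open>a\<close> and \<open>a + 1\<close>, hence constant;
  it cancels in the difference of two potentials.\<close>

lemma simple_refl_root:
  "simple_refl i (affine_root a b) = affine_root (simple_gen i a) (simple_gen (i :: 'n::nontriv mod_ring) b)"
proof -
  let ?f = "\<lambda>a. simple_refl i (root_pot a) - root_pot (simple_gen i a)"
  have "?f (a + 1) = ?f a" for a
    using simple_refl_simple_root[of i a]
    by (simp add: simple_root_eq affine_root_def simple_refl_diff algebra_simps)
  from int_step_const[where f = ?f, OF this] have "?f a = ?f b" .
  then show ?thesis by (simp add: affine_root_def simple_refl_diff algebra_simps)
qed

lemma foldr_simple_refl_root: "foldr simple_refl u (affine_root a b) = affine_root (word_perm u a) (word_perm u b)"
  by (induction u) (simp_all add: word_perm_Cons simple_refl_root)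


section \<open>Inversions and length\<close>

text \<open>Pairs \<open>(c, d)\<close> are positions, so the inverted values \<open>w d < w c\<close> span the root.\<close>

definition inversions :: "(int \<Rightarrow> int) \<Rightarrow> (int ^ ('n::nontriv mod_ring)) set" where
  "inversions w = {affine_root (w d) (w c) | c d. c < d \<and> w d < w c}"

lemma inversions_id: "inversions id = {}" "inversions (\<lambda>a. a) = {}"
  by (auto simp: inversions_def)

text \<open>Congruent positions differ by a multiple of n and \<open>w\<close> preserves this
  difference, so they are never inverted. This supplies the residue condition of
  \<open>root_eqD\<close>.\<close>

lemma inversion_residues:
  assumes w: "periodic_perm TYPE('n::nontriv) w" and "c < d" "w d < w c"
  shows "(of_int (w d) :: 'n mod_ring) \<noteq> of_int (w c)"
proof
  assume "(of_int (w d) :: 'n mod_ring) = of_int (w c)"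
  then have "(of_int d :: 'n mod_ring) = of_int c" by (simp add: periodic_perm_residue_eq[OF w])
  then obtain k where k: "c = d + k * int CARD('n)" by (auto simp: residue_eq_iff)
  then show False using assms periodic_perm_add_mult[OF w, of d k] by simp
qed

text \<open>Many pairs give the same root, but by \<open>root_eqD\<close> they are common shifts by
  multiples of n, and such shifts do not affect whether the pair is inverted.\<close>

lemma root_mem_inversions:
  assumes w: "periodic_perm TYPE('n::nontriv) w" and "a < b"
  shows "(affine_root a b :: int ^ ('n mod_ring)) \<in> inversions w \<longleftrightarrow> inv_into UNIV w b < inv_into UNIV w a"
proof
  assume "inv_into UNIV w b < inv_into UNIV w a"
  then show "(affine_root a b :: int ^ ('n mod_ring)) \<in> inversions w"
    unfolding inversions_def mem_Collect_eq
    using \<open>a < b\<close> periodic_perm_inv(1)[OF w] by metis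
next
  assume "(affine_root a b :: int ^ ('n mod_ring)) \<in> inversions w"
  then obtain c d where cd: "c < d" "w d < w c"
    and eq: "affine_root (w d) (w c) = (affine_root a b :: int ^ ('n mod_ring))"
    by (auto simp: inversions_def)
  obtain k where "a = w d + k * int CARD('n)" "b = w c + k * int CARD('n)"
    using root_eqD[OF eq inversion_residues[OF w cd]] by blast
  then have "a = w (d + k * int CARD('n))" "b = w (c + k * int CARD('n))"
    by (simp_all add: periodic_perm_add_mult[OF w])
  then show "inv_into UNIV w b < inv_into UNIV w a"
    using cd by (simp add: periodic_perm_inv(2)[OF w])
qed

text \<open>\<open>simple_gen\<close> moves a number by at most one. A pair at distance two could
  collide only if \<open>c\<close> moved up and \<open>d\<close> down, which asks for the residues
  \<open>i\<close> and \<open>i + 1\<close>.\<close>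

lemma simple_gen_mono:
  assumes "c < d" "\<not> (of_int c = i \<and> d = c + 1)"
  shows "simple_gen (i :: 'n::nontriv mod_ring) c < simple_gen i d"
proof -
  have bounds: "simple_gen i c \<le> c + 1" "d - 1 \<le> simple_gen i d"
    by (auto simp: simple_gen_def)
  have low: "simple_gen i c \<le> c" if "of_int c \<noteq> i"
    using that by (simp add: simple_gen_def)
  have high: "d \<le> simple_gen i d" if "of_int d \<noteq> i + 1"
    using that by (simp add: simple_gen_def)
  consider "d = c + 1" | "d = c + 2" | "c + 3 \<le> d" using assms(1) by linarith
  then show ?thesis
  proof cases
    case 1
    then have "of_int c \<noteq> i" using assms(2) by simp
    moreover have "of_int d \<noteq> i + 1" using 1 \<open>of_int c \<noteq> i\<close> by simp
    ultimately show ?thesis using low high assms(1) by linarith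
  next
    case 2
    show ?thesis
    proof (cases "of_int c = i")
      case True
      have "of_int d = (i + 1) + 1" using 2 True by simp
      then have "of_int d \<noteq> i + 1" by (simp only: add_cancel_right_right) simp
      then show ?thesis using high bounds 2 by linarith
    next
      case False
      then show ?thesis using low bounds 2 by linarith
    qed
  next
    case 3
    then show ?thesis using bounds by linarith
  qed
qed

text \<open>Precomposing with \<open>simple_gen i\<close> permutes the ordered pairs of positions
  except for the shifts of \<open>(a, a + 1)\<close>, which it reverses; by
  \<open>root_shift\<close> all of these give one and the same new root.\<close>

lemma inversions_ascent:
  fixes i :: "'n::nontriv mod_ring"
  assumes w: "periodic_perm TYPE('n) w" and a: "of_int a = i" and asc: "w a < w (a + 1)"
  shows "inversions (w \<circ> simple_gen i)
      = insert (affine_root (w a) (w (a + 1))) (inversions w :: (int ^ ('n mod_ring)) set)"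
    and "affine_root (w a) (w (a + 1)) \<notin> (inversions w :: (int ^ ('n mod_ring)) set)"
proof -
  let ?s = "simple_gen i"
  have swapped: "\<exists>k. c = a + k * int CARD('n)" if "of_int c = i" for c
    using that a residue_eq_iff[of a c, where 'n = 'n] by simp
  show "affine_root (w a) (w (a + 1)) \<notin> (inversions w :: (int ^ ('n mod_ring)) set)"
    using root_mem_inversions[OF w asc] periodic_perm_inv(2)[OF w] by simp
  show "inversions (w \<circ> ?s) = insert (affine_root (w a) (w (a + 1))) (inversions w :: (int ^ ('n mod_ring)) set)"
  proof (intro equalityI subsetI)
    fix r :: "int ^ ('n mod_ring)" assume "r \<in> inversions (w \<circ> ?s)"
    then obtain c d where cd: "c < d" "w (?s d) < w (?s c)" and r: "r = affine_root (w (?s d)) (w (?s c))"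
      by (auto simp: inversions_def)
    show "r \<in> insert (affine_root (w a) (w (a + 1))) (inversions w)"
    proof (cases "of_int c = i \<and> d = c + 1")
      case True
      then obtain k where k: "c = a + k * int CARD('n)" using swapped by blast
      have "?s d = a + k * int CARD('n)" "?s c = (a + 1) + k * int CARD('n)"
        using True k by (simp_all add: simple_gen_left simple_gen_right)
      then show ?thesis by (simp only: r periodic_perm_add_mult[OF w] root_shift) simp
    next
      case False
      then show ?thesis using simple_gen_mono[OF cd(1) False] cd(2) r by (auto simp: inversions_def)
    qed
  next
    fix r :: "int ^ ('n mod_ring)" assume "r \<in> insert (affine_root (w a) (w (a + 1))) (inversions w)"
    then consider "r = affine_root (w a) (w (a + 1))" | "r \<in> inversions w" by blast
    then show "r \<in> inversions (w \<circ> ?s)"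
    proof cases
      case 1
      have "?s (a + 1) = a" "?s a = a + 1" using a by (simp_all add: simple_gen_left simple_gen_right)
      then show ?thesis using asc 1 unfolding inversions_def mem_Collect_eq
        by (intro exI[of _ a] exI[of _ "a + 1"]) simp
    next
      case 2
      then obtain c d where cd: "c < d" "w d < w c" and r: "r = affine_root (w d) (w c)"
        by (auto simp: inversions_def)
      have "\<not> (of_int c = i \<and> d = c + 1)"
      proof
        assume cd': "of_int c = i \<and> d = c + 1"
        then obtain k where k: "c = a + k * int CARD('n)" using swapped by blast
        then have "d = (a + 1) + k * int CARD('n)" using cd' by simp
        then have "w d = w (a + 1) + k * int CARD('n)" by (simp only: periodic_perm_add_mult[OF w])
        then show False using k cd asc periodic_perm_add_mult[OF w, of a k] by simp
      qed
      from simple_gen_mono[OF cd(1) this]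
      show ?thesis using cd r unfolding inversions_def mem_Collect_eq
        by (intro exI[of _ "?s c"] exI[of _ "?s d"]) simp
    qed
  qed
qed

lemma finite_root_window: "finite {affine_root a b | a b. l \<le> a \<and> a < u \<and> a < b \<and> b < a + m}"
proof (rule finite_subset)
  show "{affine_root a b | a b. l \<le> a \<and> a < u \<and> a < b \<and> b < a + m}
      \<subseteq> (\<lambda>(a, b). affine_root a b) ` ({l..u} \<times> {l..u + m})" by fastforce
qed simp

text \<open>Periodicity bounds the displacement of \<open>w\<close>, hence the height of an inverted
  root, and a shift brings its first endpoint into a fixed window.\<close>

lemma finite_inversions:
  assumes w: "periodic_perm TYPE('n::nontriv) w"
  shows "finite (inversions w :: (int ^ ('n mod_ring)) set)"
proof -
  define C where "C = Max ((\<lambda>x :: 'n mod_ring. \<bar>w (to_int_mod_ring x) - to_int_mod_ring x\<bar>) ` UNIV)"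
  have C: "\<bar>w j - j\<bar> \<le> C" for j
  proof -
    have "w (to_int_mod_ring (of_int j :: 'n mod_ring)) - to_int_mod_ring (of_int j :: 'n mod_ring) = w j - j"
      by (rule periodic_factor[where f = "\<lambda>j. w j - j"]) (simp add: periodic_perm_add_mult[OF w])
    then show ?thesis unfolding C_def by (intro Max_ge) (auto intro!: image_eqI[of _ _ "of_int j"])
  qed
  have "inversions w \<subseteq> {affine_root a b :: int ^ ('n mod_ring) | a b.
      0 \<le> a \<and> a < int CARD('n) \<and> a < b \<and> b < a + (2 * C + 1)}"
  proof
    fix r :: "int ^ ('n mod_ring)" assume "r \<in> inversions w"
    then obtain c d where cd: "c < d" "w d < w c" and r: "r = affine_root (w d) (w c)"
      by (auto simp: inversions_def)
    define k where "k = - (w d div int CARD('n))"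
    have "w d + k * int CARD('n) = w d mod int CARD('n)"
      unfolding k_def by (simp add: minus_div_mult_eq_mod[symmetric])
    then have "0 \<le> w d + k * int CARD('n)" "w d + k * int CARD('n) < int CARD('n)"
      using card_gt_1[where 'n = 'n] by auto
    moreover have "w c < w d + (2 * C + 1)" using C[of c] C[of d] cd by linarith
    moreover have "r = affine_root (w d + k * int CARD('n)) (w c + k * int CARD('n))"
      by (simp add: r root_shift)
    ultimately show "r \<in> {affine_root a b :: int ^ ('n mod_ring) | a b.
      0 \<le> a \<and> a < int CARD('n) \<and> a < b \<and> b < a + (2 * C + 1)}" using cd(2) by force
  qed
  then show ?thesis using finite_root_window finite_subset by blast
qed

section \<open>Coxeter length as the number of inversions\<close>

lemma card_inversions_ascent:
  fixes i :: "'n::nontriv mod_ring"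
  assumes w: "periodic_perm TYPE('n) w" and a: "of_int a = i" and asc: "w a < w (a + 1)"
  shows "card (inversions (w \<circ> simple_gen i) :: (int ^ ('n mod_ring)) set)
      = Suc (card (inversions w :: (int ^ ('n mod_ring)) set))"
  using inversions_ascent[OF assms] finite_inversions[OF w] by simp

lemma card_inversions_descent:
  fixes i :: "'n::nontriv mod_ring"
  assumes w: "periodic_perm TYPE('n) w" and a: "of_int a = i" and desc: "w (a + 1) < w a"
  shows "card (inversions w :: (int ^ ('n mod_ring)) set)
      = Suc (card (inversions (w \<circ> simple_gen i) :: (int ^ ('n mod_ring)) set))"
proof -
  let ?v = "w \<circ> simple_gen i"
  have "?v \<circ> simple_gen i = w" by (simp add: fun_eq_iff)
  moreover have "?v a < ?v (a + 1)"
    using a desc by (simp add: simple_gen_left simple_gen_right)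
  ultimately show ?thesis
    using card_inversions_ascent[OF periodic_perm_comp[OF w simple_gen_perm[of i]] a] by simp
qed

lemma ascent_or_descent:
  assumes w: "periodic_perm TYPE('n::nontriv) w"
  shows "w a < w (a + 1) \<or> w (a + 1) < w a"
  using periodic_perm_eq_iff[OF w, of a "a + 1"] by linarith

text \<open>An increasing bijection of the integers is a shift, since no position could take a value
  skipped between neighbours; the normalisation leaves only the zero shift.\<close>

lemma no_descent_id:
  assumes w: "w \<in> affine_sym TYPE('n::nontriv)" and asc: "\<And>a. w a < w (a + 1)"
  shows "w = id"
proof -
  have per: "periodic_perm TYPE('n) w" and sum0: "(\<Sum>i = 1..int CARD('n). w i - i) = 0"
    using w by (auto simp: affine_sym_iff)
  have mono: "w a < w b" if "a < b" for a b
    using that by (induction b rule: int_gr_induct) (use asc order_less_trans in blast)+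
  have step: "w (a + 1) = w a + 1" for a
  proof (rule ccontr)
    assume "w (a + 1) \<noteq> w a + 1"
    then have less: "w a < w a + 1" "w a + 1 < w (a + 1)" using asc[of a] by simp_all
    obtain x where x: "w x = w a + 1" using periodic_perm_inv(1)[OF per] by metis
    have "a < x" using less(1) x mono by (metis linorder_neqE_linordered_idom order_less_asym)
    moreover have "x < a + 1"
      using less(2) x mono by (metis linorder_neqE_linordered_idom order_less_asym)
    ultimately show False by simp
  qed
  have const: "w a - a = w 0" for a
    using int_step_const[where f = "\<lambda>a. w a - a" and a = a and b = 0] step by simp
  then have "w 0 = 0" using sum0 by simp
  then show ?thesis using const by (simp add: fun_eq_iff)
qed

text \<open>Bubble sort: while there is a descent, multiplying by its generator removes exactly one
  inversion, and \<open>no_descent_id\<close> says where this ends.\<close>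

lemma exists_short_word:
  assumes "w \<in> affine_sym TYPE('n::nontriv)"
  shows "\<exists>u :: 'n mod_ring list. word_perm u = w \<and>
    length u = card (inversions w :: (int ^ ('n mod_ring)) set)"
  using assms
proof (induction "card (inversions w :: (int ^ ('n mod_ring)) set)" arbitrary: w rule: less_induct)
  case less
  have per: "periodic_perm TYPE('n) w" using less.prems by (simp add: affine_sym_iff)
  show ?case
  proof (cases "\<forall>a. w a < w (a + 1)")
    case True
    then have "w = id" using no_descent_id[OF less.prems] by blast
    then show ?thesis by (intro exI[of _ "[]"]) (simp add: inversions_id)
  next
    case False
    then obtain a where a: "w (a + 1) < w a" using ascent_or_descent[OF per] by blast
    define i where "i = (of_int a :: 'n mod_ring)"
    note card = card_inversions_descent[OF per i_def[symmetric] a]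
    obtain u :: "'n mod_ring list" where u: "word_perm u = w \<circ> simple_gen i"
      "length u = card (inversions (w \<circ> simple_gen i) :: (int ^ ('n mod_ring)) set)"
      using less.hyps[OF _ affine_sym_simple_gen[OF less.prems, of i]] card by auto
    then have "word_perm (u @ [i]) = w" by (simp add: word_perm_snoc fun_eq_iff)
    then show ?thesis using u card by (intro exI[of _ "u @ [i]"]) simp
  qed
qed

lemma card_inversions_snoc:
  fixes u :: "'n::nontriv mod_ring list"
  shows "card (inversions (word_perm (u @ [i])) :: (int ^ ('n mod_ring)) set)
     \<le> Suc (card (inversions (word_perm u) :: (int ^ ('n mod_ring)) set))"
proof -
  let ?a = "to_int_mod_ring i"
  have a: "of_int ?a = i" by simp
  show ?thesis
    using ascent_or_descent[OF word_perm_perm[of u], of ?a]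
      card_inversions_ascent[OF word_perm_perm[of u] a]
      card_inversions_descent[OF word_perm_perm[of u] a]
    by (auto simp: word_perm_snoc)
qed

lemma card_inversions_le:
  fixes u :: "'n::nontriv mod_ring list"
  shows "card (inversions (word_perm u) :: (int ^ ('n mod_ring)) set) \<le> length u"
proof (induction u rule: rev_induct)
  case Nil
  show ?case by (simp add: inversions_id)
next
  case (snoc i u)
  then show ?case using card_inversions_snoc[of u i] by simp
qed

text \<open>Sorting gives a word with as many letters as inversions; no shorter one exists, as each
  letter adds at most one inversion.\<close>

lemma affine_length_eq:
  assumes "w \<in> affine_sym TYPE('n::nontriv)"
  shows "affine_length TYPE('n) w = card (inversions w :: (int ^ ('n mod_ring)) set)"
  unfolding affine_length_def
  by (rule Least_equality) (use exists_short_word[OF assms] card_inversions_le in fast)+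

lemma reduced_word_iff:
  fixes u :: "'n::nontriv mod_ring list"
  shows "reduced_word u \<longleftrightarrow> card (inversions (word_perm u) :: (int ^ ('n mod_ring)) set) = length u"
  by (simp add: reduced_word_def affine_length_eq[OF word_perm_affine_sym])

lemma reduced_word_Nil [simp]: "reduced_word ([] :: 'n::nontriv mod_ring list)"
  by (simp add: reduced_word_iff inversions_id)

text \<open>The inversion count reaches the length only if it rises with every letter. This is the
  letterwise criterion for later inductions on words.\<close>

lemma reduced_word_snoc:
  fixes i :: "'n::nontriv mod_ring" and u :: "'n mod_ring list"
  assumes a: "of_int a = i"
  shows "reduced_word (u @ [i]) \<longleftrightarrow> reduced_word u \<and> word_perm u a < word_perm u (a + 1)"
  using ascent_or_descent[OF word_perm_perm[of u], of a]
    card_inversions_ascent[OF word_perm_perm[of u] a]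
    card_inversions_descent[OF word_perm_perm[of u] a]
    card_inversions_le[of u] card_inversions_le[of "u @ [i]"]
  by (auto simp: reduced_word_iff word_perm_snoc)

lemma word_inv_snoc:
  fixes i :: "'n::nontriv mod_ring"
  assumes a: "of_int a = i"
  shows "word_inv (u @ [i]) = insert (affine_root (word_perm u a) (word_perm u (a + 1))) (word_inv u)"
proof -
  have "{..<length (u @ [i])} = insert (length u) {..<length u}" by auto
  then show ?thesis
    using a foldr_simple_refl_root[of u a "a + 1"] simple_root_eq[of a, where 'n = 'n]
    by (auto simp: word_inv_def nth_append)
qed

text \<open>Both sets gain the same root with each letter, by \<open>word_inv_snoc\<close> and
  \<open>inversions_ascent\<close>. In particular the set depends only on the permutation.\<close>

lemma word_inv_eq_inversions:
  fixes u :: "'n::nontriv mod_ring list"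
  shows "reduced_word u \<Longrightarrow> word_inv u = (inversions (word_perm u) :: (int ^ ('n mod_ring)) set)"
proof (induction u rule: rev_induct)
  case Nil
  then show ?case by (simp add: word_inv_def inversions_id)
next
  case (snoc i u)
  have a: "of_int (to_int_mod_ring i) = i" by simp
  note red = snoc.prems[unfolded reduced_word_snoc[OF a]]
  show ?case
    using snoc.IH red inversions_ascent(1)[OF word_perm_perm[of u] a]
    by (simp only: word_inv_snoc[OF a] word_perm_snoc)
qed


section \<open>Limits of inversion sets\<close>

lemma prefix_word_Suc: "prefix_word (Suc k) a = prefix_word k a @ [a k]"
  by (simp add: prefix_word_def)

lemma length_prefix_word [simp]: "length (prefix_word k a) = k"
  by (simp add: prefix_word_def)

lemma inf_reduced_iff: "inf_reduced a \<longleftrightarrow> (\<forall>k. reduced_word (prefix_word k a))"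
  by (simp add: inf_reduced_def reduced_word_def)

lemma word_inv_append_subset: "word_inv u \<subseteq> word_inv (u @ v)"
proof (induction v rule: rev_induct)
  case (snoc i v)
  have "of_int (to_int_mod_ring i) = i" by simp
  from word_inv_snoc[OF this, of "u @ v"] show ?case using snoc by auto
qed simp

lemma word_inv_prefix_mono: "s \<le> t \<Longrightarrow> word_inv (prefix_word s a) \<subseteq> word_inv (prefix_word t a)"
proof (induction t rule: dec_induct)
  case (step t)
  then show ?case using word_inv_append_subset[of "prefix_word t a" "[a t]"]
    by (simp add: prefix_word_Suc)
qed simp

text \<open>Where the value \<open>c\<close> stands after \<open>t\<close> letters. The root of a
  pair \<open>c < d\<close> is inverted when \<open>d\<close> stands before
  \<open>c\<close>.\<close>

definition position :: "(nat \<Rightarrow> 'n::nontriv mod_ring) \<Rightarrow> nat \<Rightarrow> int \<Rightarrow> int" where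
  "position a t = inv_into UNIV (word_perm (prefix_word t a))"

lemma position_shift:
  fixes a :: "nat \<Rightarrow> 'n::nontriv mod_ring"
  shows "position a t (c + k * int CARD('n)) = position a t c + k * int CARD('n)"
proof -
  let ?w = "word_perm (prefix_word t a)"
  have w: "periodic_perm TYPE('n) ?w" by (rule word_perm_perm)
  have "?w (position a t c + k * int CARD('n)) = c + k * int CARD('n)"
    by (simp add: periodic_perm_add_mult[OF w] periodic_perm_inv(1)[OF w] position_def)
  then show ?thesis
    using periodic_perm_inv(2)[OF w, of "position a t c + k * int CARD('n)"]
    by (simp add: position_def)
qed

lemma position_inj:
  fixes a :: "nat \<Rightarrow> 'n::nontriv mod_ring"
  shows "position a t c = position a t d \<longleftrightarrow> c = d"
  using periodic_perm_inv(1)[OF word_perm_perm[of "prefix_word t a"]]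
  unfolding position_def by metis

lemma root_mem_word_inv_prefix:
  fixes a :: "nat \<Rightarrow> 'n::nontriv mod_ring"
  assumes "inf_reduced a" "c < d"
  shows "affine_root c d \<in> word_inv (prefix_word t a) \<longleftrightarrow> position a t d < position a t c"
  using assms root_mem_inversions[OF word_perm_perm[of "prefix_word t a"], of c d]
  by (simp add: inf_reduced_iff word_inv_eq_inversions position_def)

text \<open>Prefix inversion sets grow, so a reversed pair stays reversed; comparisons made at
  different times can thus be combined at a later one.\<close>

lemma position_mono:
  fixes a :: "nat \<Rightarrow> 'n::nontriv mod_ring"
  assumes "inf_reduced a" "c < d" "s \<le> t" "position a s d < position a s c"
  shows "position a t d < position a t c"
  using assms root_mem_word_inv_prefix[OF assms(1,2)] word_inv_prefix_mono[OF assms(3), of a] by blast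

lemma root_mem_inf_inv:
  fixes a :: "nat \<Rightarrow> 'n::nontriv mod_ring"
  assumes "inf_reduced a" "c < d"
  shows "affine_root c d \<in> inf_inv a \<longleftrightarrow> (\<exists>t. position a t d < position a t c)"
  using root_mem_word_inv_prefix[OF assms] by (simp add: inf_inv_def)

text \<open>A reduced prefix of length k contributes exactly k roots.\<close>

lemma infinite_inf_inv:
  fixes a :: "nat \<Rightarrow> 'n::nontriv mod_ring"
  assumes a: "inf_reduced a"
  shows "infinite (inf_inv a)"
proof
  assume fin: "finite (inf_inv a)"
  let ?k = "Suc (card (inf_inv a))"
  have "card (word_inv (prefix_word ?k a)) = ?k"
    using a reduced_word_iff[of "prefix_word ?k a"]
    by (simp add: inf_reduced_iff word_inv_eq_inversions)
  moreover have "card (word_inv (prefix_word ?k a)) \<le> card (inf_inv a)"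
    using fin by (intro card_mono) (auto simp: inf_inv_def)
  ultimately show False by simp
qed

section \<open>Strings of roots and the limit relation\<close>

definition root_string :: "'n::nontriv mod_ring \<Rightarrow> 'n mod_ring \<Rightarrow> (int ^ ('n mod_ring)) set" where
  "root_string x y = {affine_root c d | c d. of_int c = x \<and> of_int d = y \<and> c < d}"

text \<open>On the inversion set of a limit element this is the strict part of the total preorder
  that describes its face.\<close>

definition lim_rel :: "(int ^ ('n::nontriv mod_ring)) set \<Rightarrow> ('n mod_ring \<times> 'n mod_ring) set" where
  "lim_rel I = {(x, y). infinite (root_string x y \<inter> I)}"

lemma lim_rel_mono: "I \<subseteq> J \<Longrightarrow> lim_rel I \<subseteq> lim_rel J"
  unfolding lim_rel_def using finite_subset[OF Int_mono[OF subset_refl]] by blast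

lemma residue_above:
  fixes y :: "'n::nontriv mod_ring"
  obtains d where "c < d" "of_int d = y"
proof -
  define d where "d = to_int_mod_ring y + (\<bar>c - to_int_mod_ring y\<bar> + 1) * int CARD('n)"
  have "\<bar>c - to_int_mod_ring y\<bar> + 1 \<le> (\<bar>c - to_int_mod_ring y\<bar> + 1) * int CARD('n)"
    using card_gt_1[where 'n = 'n] mult_left_mono[of 1 "int CARD('n)" "\<bar>c - to_int_mod_ring y\<bar> + 1"]
    by simp
  then have "c < d" unfolding d_def by linarith
  moreover have "of_int d = y" unfolding d_def by simp
  ultimately show ?thesis by (rule that)
qed

lemma infinite_root_string: "infinite (root_string x (y :: 'n::nontriv mod_ring))"
proof
  assume fin: "finite (root_string x y)"
  obtain d where d: "to_int_mod_ring x < d" "of_int d = y"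
    by (rule residue_above)
  \<comment> \<open>Raising the upper endpoint by multiples of n gives roots of distinct heights in
    the string.\<close>
  define f where "f k = (affine_root (to_int_mod_ring x) (d + int k * int CARD('n)) :: int ^ ('n mod_ring))"
    for k :: nat
  have "inj f"
  proof (rule injI)
    fix k m assume eq: "f k = f m"
    have height: "(\<Sum>i\<in>UNIV. f k $ i) = d + int k * int CARD('n) - to_int_mod_ring x" for k
      unfolding f_def by (rule root_height)
    have "int k * int CARD('n) = int m * int CARD('n)"
      using height[of k] height[of m] unfolding eq by linarith
    then show "k = m" by simp
  qed
  moreover have "range f \<subseteq> root_string x y"
  proof
    fix r assume "r \<in> range f"
    then obtain k where k: "r = f k" by blast
    have "0 \<le> int k * int CARD('n)" by simp
    then have "to_int_mod_ring x < d + int k * int CARD('n)" using d(1) by linarith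
    then show "r \<in> root_string x y" unfolding k f_def root_string_def mem_Collect_eq
      using d(2) by (intro exI conjI) auto
  qed
  ultimately show False using fin finite_subset range_inj_infinite by blast
qed

text \<open>Since \<open>position\<close> commutes with shifts by n, a smaller \<open>d'\<close> of
  the same residue stands no later than \<open>d\<close>, so it has passed \<open>c\<close> as
  well.\<close>

lemma inf_inv_string_initial:
  fixes a :: "nat \<Rightarrow> 'n::nontriv mod_ring"
  assumes a: "inf_reduced a" and cd: "affine_root c d \<in> inf_inv a" "c < d'" "d' \<le> d"
    and res: "(of_int d' :: 'n mod_ring) = of_int d"
  shows "affine_root c d' \<in> inf_inv a"
proof -
  obtain k where k: "d = d' + k * int CARD('n)" using res residue_eq_iff by blast
  then have "0 \<le> k * int CARD('n)" using cd(3) by simp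
  moreover obtain t where "position a t d < position a t c"
    using cd root_mem_inf_inv[OF a, of c d] by auto
  ultimately have "position a t d' < position a t c" using k by (simp add: position_shift)
  then show ?thesis using root_mem_inf_inv[OF a cd(2)] by blast
qed

text \<open>The inverted part of a string is an initial segment, so it is infinite only if it is
  everything.\<close>

lemma lim_rel_inf_inv:
  fixes a :: "nat \<Rightarrow> 'n::nontriv mod_ring"
  assumes a: "inf_reduced a"
  shows "(x, y) \<in> lim_rel (inf_inv a) \<longleftrightarrow>
    (\<forall>c d. of_int c = x \<and> of_int d = y \<and> c < d \<longrightarrow> affine_root c d \<in> inf_inv a)"
proof
  assume "\<forall>c d. of_int c = x \<and> of_int d = y \<and> c < d \<longrightarrow> affine_root c d \<in> inf_inv a"
  then have "root_string x y \<inter> inf_inv a = root_string x y" by (auto simp: root_string_def)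
  then show "(x, y) \<in> lim_rel (inf_inv a)" by (simp add: lim_rel_def infinite_root_string)
next
  assume xy: "(x, y) \<in> lim_rel (inf_inv a)"
  show "\<forall>c d. of_int c = x \<and> of_int d = y \<and> c < d \<longrightarrow> affine_root c d \<in> inf_inv a"
  proof (intro allI impI, elim conjE)
    fix c d assume c: "of_int c = x" and d: "of_int d = y" and "c < d"
    \<comment> \<open>Shifting fixes the lower endpoint at \<open>c\<close>, so \<open>S\<close>
      records the string by its upper endpoints. An infinite \<open>S\<close>, bounded below by
      \<open>c\<close>, reaches beyond \<open>d\<close>.\<close>
    define S where "S = {b. of_int b = y \<and> c < b \<and> affine_root c b \<in> inf_inv a}"
    have "root_string x y \<inter> inf_inv a \<subseteq> affine_root c ` S"
    proof
      fix r assume "r \<in> root_string x y \<inter> inf_inv a"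
      then obtain c' d' where r: "r = affine_root c' d'" "r \<in> inf_inv a"
        and res: "of_int c' = x" "of_int d' = y" and "c' < d'"
        by (auto simp: root_string_def)
      obtain k where k: "c = c' + k * int CARD('n)"
        using c res(1) residue_eq_iff[of c' c, where 'n = 'n] by auto
      have "r = affine_root c (d' + k * int CARD('n))" by (simp add: r k root_shift)
      moreover have "d' + k * int CARD('n) \<in> S"
        using calculation r res(2) \<open>c' < d'\<close> k by (simp add: S_def)
      ultimately show "r \<in> affine_root c ` S" by blast
    qed
    then have "infinite S" using xy finite_subset by (auto simp: lim_rel_def)
    then have "\<not> S \<subseteq> {c..d}" using finite_subset by blast
    then obtain b where "b \<in> S" "d < b" by (force simp: S_def)
    then show "affine_root c d \<in> inf_inv a"
      using inf_inv_string_initial[OF a _ \<open>c < d\<close>, of b] d by (simp add: S_def)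
  qed
qed

text \<open>Values that differ by n stay exactly n apart and are never reversed.\<close>

lemma lim_rel_irrefl:
  fixes a :: "nat \<Rightarrow> 'n::nontriv mod_ring"
  assumes a: "inf_reduced a"
  shows "(x, x) \<notin> lim_rel (inf_inv a)"
proof
  assume "(x, x) \<in> lim_rel (inf_inv a)"
  moreover have less: "to_int_mod_ring x < to_int_mod_ring x + 1 * int CARD('n)" by simp
  ultimately have "affine_root (to_int_mod_ring x) (to_int_mod_ring x + 1 * int CARD('n)) \<in> inf_inv a"
    unfolding lim_rel_inf_inv[OF a] by auto
  then show False unfolding root_mem_inf_inv[OF a less] position_shift by simp
qed

lemma lim_rel_trans:
  fixes a :: "nat \<Rightarrow> 'n::nontriv mod_ring"
  assumes a: "inf_reduced a"
    and xy: "(x, y) \<in> lim_rel (inf_inv a)" and yz: "(y, z) \<in> lim_rel (inf_inv a)"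
  shows "(x, z) \<in> lim_rel (inf_inv a)"
  unfolding lim_rel_inf_inv[OF a]
proof (intro allI impI, elim conjE)
  fix c d assume c: "of_int c = x" and d: "of_int d = z" and cd: "c < d"
  obtain b where b: "c < b" "of_int b = y" by (rule residue_above)
  \<comment> \<open>\<open>e\<close> lies above \<open>b\<close>, so that the second relation
    applies to \<open>b\<close> and \<open>e\<close>, and above \<open>d\<close>, so that the
    initial-segment property brings the conclusion back to \<open>d\<close>.\<close>
  obtain e where e: "max b d < e" "of_int e = z" by (rule residue_above)
  obtain s where "position a s b < position a s c"
    using xy[unfolded lim_rel_inf_inv[OF a]] b c root_mem_inf_inv[OF a b(1)] by blast
  moreover obtain t where "position a t e < position a t b"
    using yz[unfolded lim_rel_inf_inv[OF a]] b e root_mem_inf_inv[OF a, of b e] by auto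
  ultimately have "position a (max s t) b < position a (max s t) c"
    "position a (max s t) e < position a (max s t) b"
    using position_mono[OF a b(1) max.cobounded1] position_mono[OF a _ max.cobounded2, of b e] e(1)
    by simp_all
  then have "affine_root c e \<in> inf_inv a"
    using root_mem_inf_inv[OF a, of c e] e b by (auto intro: order_less_trans)
  then show "affine_root c d \<in> inf_inv a"
    using inf_inv_string_initial[OF a _ cd, of e] e d by simp
qed

text \<open>Some \<open>c < b\<close> in the string of \<open>(x, y)\<close> is never reversed, so
  \<open>c\<close> always stands before \<open>b\<close>; each \<open>d\<close> above
  \<open>b\<close> of residue \<open>z\<close> eventually stands before \<open>c\<close>, hence
  before \<open>b\<close>. A shift carries the given pair to such \<open>b\<close> and
  \<open>d\<close>.\<close>

lemma lim_rel_neg_trans: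
  fixes a :: "nat \<Rightarrow> 'n::nontriv mod_ring"
  assumes a: "inf_reduced a" and xz: "(x, z) \<in> lim_rel (inf_inv a)"
    and xy: "(x, y) \<notin> lim_rel (inf_inv a)"
  shows "(y, z) \<in> lim_rel (inf_inv a)"
  unfolding lim_rel_inf_inv[OF a]
proof (intro allI impI, elim conjE)
  fix b' d' assume b': "of_int b' = y" and d': "of_int d' = z" and less: "b' < d'"
  obtain c b where c: "of_int c = x" and b: "of_int b = y" and cb: "c < b"
    and notin: "affine_root c b \<notin> inf_inv a"
    using xy[unfolded lim_rel_inf_inv[OF a]] by blast
  obtain k where k: "b = b' + k * int CARD('n)"
    using b b' residue_eq_iff[of b' b, where 'n = 'n] by auto
  define d where "d = d' + k * int CARD('n)"
  have bd: "b < d" and d: "of_int d = z" using less d' by (simp_all add: d_def k)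
  have "affine_root c d \<in> inf_inv a"
    using xz[unfolded lim_rel_inf_inv[OF a]] c d cb bd by auto
  then obtain t where "position a t d < position a t c"
    using root_mem_inf_inv[OF a, of c d] cb bd by auto
  also have "position a t c < position a t b"
    using notin root_mem_inf_inv[OF a cb] position_inj[of a t c b] cb
    by (metis linorder_neqE_linordered_idom order_less_irrefl)
  finally have "affine_root b d \<in> inf_inv a" using root_mem_inf_inv[OF a bd] by blast
  then show "affine_root b' d' \<in> inf_inv a" by (simp add: d_def k root_shift)
qed

lemma inf_inv_subset_strings: "inf_inv a \<subseteq> (\<Union>(x, y)\<in>UNIV. root_string x y)" if "inf_reduced a"
proof
  fix r assume "r \<in> inf_inv a"
  then obtain k where "r \<in> word_inv (prefix_word k a)" by (auto simp: inf_inv_def)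
  then have "r \<in> inversions (word_perm (prefix_word k a))"
    using that by (simp add: inf_reduced_iff word_inv_eq_inversions)
  then show "r \<in> (\<Union>(x, y)\<in>UNIV. root_string x y)"
    by (auto simp: inversions_def root_string_def)
qed

text \<open>There are finitely many strings. One outside the relation of \<open>a\<close> meets
  \<open>inf_inv a\<close> in a finite set; one inside it is full for \<open>b\<close> as soon as
  the relations are included.\<close>

lemma finite_diff_iff_lim_rel:
  assumes a: "inf_reduced a" and b: "inf_reduced b"
  shows "finite (inf_inv a - inf_inv b) \<longleftrightarrow> lim_rel (inf_inv a) \<subseteq> lim_rel (inf_inv b)"
proof
  assume fin: "finite (inf_inv a - inf_inv b)"
  show "lim_rel (inf_inv a) \<subseteq> lim_rel (inf_inv b)"
  proof (clarsimp simp: lim_rel_def)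
    fix x y assume "infinite (root_string x y \<inter> inf_inv a)" "finite (root_string x y \<inter> inf_inv b)"
    moreover have "root_string x y \<inter> inf_inv a \<subseteq> (root_string x y \<inter> inf_inv b) \<union> (inf_inv a - inf_inv b)"
      by blast
    ultimately show False using fin by (meson finite_UnI finite_subset)
  qed
next
  assume sub: "lim_rel (inf_inv a) \<subseteq> lim_rel (inf_inv b)"
  have "inf_inv a - inf_inv b \<subseteq> (\<Union>(x, y)\<in>- lim_rel (inf_inv a). root_string x y \<inter> inf_inv a)"
  proof
    fix r assume r: "r \<in> inf_inv a - inf_inv b"
    then obtain x y where xy: "r \<in> root_string x y" using inf_inv_subset_strings[OF a] by auto
    then have "(x, y) \<notin> lim_rel (inf_inv b)"
      using r lim_rel_inf_inv[OF b, of x y] by (auto simp: root_string_def)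
    then show "r \<in> (\<Union>(x, y)\<in>- lim_rel (inf_inv a). root_string x y \<inter> inf_inv a)"
      using xy r sub by blast
  qed
  moreover have "finite (\<Union>(x, y)\<in>- lim_rel (inf_inv a). root_string x y \<inter> inf_inv a)"
    by (auto simp: lim_rel_def)
  ultimately show "finite (inf_inv a - inf_inv b)" by (rule finite_subset)
qed

text \<open>Finitely many finite pieces cannot make up the infinite set
  \<open>inf_inv a\<close>.\<close>

lemma lim_rel_nonempty:
  assumes a: "inf_reduced a"
  shows "lim_rel (inf_inv a) \<noteq> {}"
proof
  assume "lim_rel (inf_inv a) = {}"
  then have "finite (\<Union>(x, y)\<in>UNIV. root_string x y \<inter> inf_inv a)"
    by (auto simp: lim_rel_def)
  moreover have "inf_inv a \<subseteq> (\<Union>(x, y)\<in>UNIV. root_string x y \<inter> inf_inv a)"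
    using inf_inv_subset_strings[OF a] by blast
  ultimately show False using infinite_inf_inv[OF a] finite_subset by blast
qed


section \<open>Powers of translations\<close>

lemma translation_pow:
  "(translation l ^^ m) i = i + int CARD('n) * int m * l $ (of_int i :: 'n::nontriv mod_ring)"
  by (induction m) (simp_all add: translation_def algebra_simps)

lemma translation_perm: "periodic_perm TYPE('n) (translation (l :: int ^ ('n::nontriv mod_ring)))"
proof -
  have "translation l \<circ> translation (- l) = id" "translation (- l) \<circ> translation l = id"
    by (simp_all add: translation_def fun_eq_iff)
  then have "bij (translation l)" by (metis o_bij)
  then show ?thesis by (simp add: periodic_perm_def translation_def)
qed

lemma inv_translation:
  "inv_into UNIV (translation l) b = b - int CARD('n) * l $ (of_int b :: 'n::nontriv mod_ring)"
proof -
  have "translation l (b - int CARD('n) * l $ (of_int b :: 'n::nontriv mod_ring)) = b"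
    by (simp add: translation_def)
  then show ?thesis using periodic_perm_inv(2)[OF translation_perm[of l]] by metis
qed

lemma translation_affine_sym:
  fixes l :: "int ^ ('n::nontriv mod_ring)"
  assumes "(\<Sum>i\<in>UNIV. l $ i) = 0"
  shows "translation l \<in> affine_sym TYPE('n)"
proof -
  have "(\<Sum>i = 1..int CARD('n). translation l i - i) = int CARD('n) * (\<Sum>i = 1..int CARD('n). l $ of_int i)"
    by (simp add: translation_def sum_distrib_left)
  then show ?thesis using assms translation_perm[of l] sum_residues[of "\<lambda>x. l $ x"]
    by (simp add: affine_sym_iff)
qed

lemma reduced_word_appendD: "reduced_word (u @ v) \<Longrightarrow> reduced_word u"
proof (induction v rule: rev_induct)
  case (snoc i v)
  have "of_int (to_int_mod_ring i) = i" by simp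
  from reduced_word_snoc[OF this, of "u @ v"] show ?case using snoc by simp
qed simp

text \<open>The root added by a letter is an inversion of the translation. By
  \<open>inv_translation\<close>, values \<open>p < q\<close> are reversed only if \<open>l\<close>
  at \<open>q\<close> exceeds \<open>l\<close> at \<open>p\<close> by more than
  \<open>(q - p) / n\<close>.\<close>

lemma reduced_translation_letter:
  fixes u :: "'n::nontriv mod_ring list" and l :: "int ^ ('n mod_ring)"
  assumes u: "reduced_word u" "word_perm u = translation l" and j: "j < length u"
  defines "v \<equiv> word_perm (take j u)" and "c \<equiv> to_int_mod_ring (u ! j)"
  shows "v c < v (c + 1)" "l $ of_int (v c) < l $ of_int (v (c + 1))"
proof -
  have c: "of_int c = u ! j" by (simp add: c_def)
  have split: "take j u @ [u ! j] @ drop (Suc j) u = u"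
    using j by (metis append.assoc append_take_drop_id take_Suc_conv_app_nth)
  have "reduced_word (take j u @ [u ! j])"
    using u(1) split reduced_word_appendD[of "take j u @ [u ! j]" "drop (Suc j) u"] by simp
  then show less: "v c < v (c + 1)" by (simp add: reduced_word_snoc[OF c] v_def)
  have "affine_root (v c) (v (c + 1)) \<in> word_inv u"
    using word_inv_snoc[OF c, of "take j u"] word_inv_append_subset[of "take j u @ [u ! j]" "drop (Suc j) u"]
      split by (auto simp: v_def)
  then have "inv_into UNIV (translation l) (v (c + 1)) < inv_into UNIV (translation l) (v c)"
    using root_mem_inversions[OF word_perm_perm[of u] less] u by (simp add: word_inv_eq_inversions)
  then have "0 < int CARD('n) * (l $ of_int (v (c + 1)) - l $ of_int (v c))"
    unfolding inv_translation right_diff_distrib using less by linarith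
  then show "l $ of_int (v c) < l $ of_int (v (c + 1))"
    by (simp add: zero_less_mult_iff)
qed

lemma word_perm_prefix_repeat:
  assumes "u \<noteq> []"
  shows "word_perm (prefix_word k (repeat_word u))
    = (word_perm u ^^ (k div length u)) \<circ> word_perm (take (k mod length u) u)"
proof (induction k)
  case 0
  then show ?case by (simp add: prefix_word_def)
next
  case (Suc k)
  let ?L = "length u"
  have "k mod ?L < ?L" using assms by simp
  then have "take (k mod ?L) u @ [u ! (k mod ?L)] = take (Suc (k mod ?L)) u"
    by (simp add: take_Suc_conv_app_nth)
  then have "word_perm (take (k mod ?L) u) \<circ> simple_gen (u ! (k mod ?L))
      = word_perm (take (Suc (k mod ?L)) u)"
    by (metis word_perm_snoc)
  then have "word_perm (prefix_word (Suc k) (repeat_word u))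
      = (word_perm u ^^ (k div ?L)) \<circ> word_perm (take (Suc (k mod ?L)) u)"
    unfolding prefix_word_Suc word_perm_snoc Suc comp_assoc repeat_word_def by (simp only:)
  also have "\<dots> = (word_perm u ^^ (Suc k div ?L)) \<circ> word_perm (take (Suc k mod ?L) u)"
    using assms by (simp add: div_Suc mod_Suc funpow_Suc_right del: funpow.simps)
  finally show ?case .
qed

text \<open>A prefix product is a power of the translation composed with a partial product of
  \<open>u\<close>. The power adds a nonnegative multiple of \<open>l\<close> to the values, and
  \<open>l\<close> increases along every ascent that \<open>u\<close> uses, so these ascents
  persist. Conversely, high powers reverse every pair along which \<open>l\<close>
  increases.\<close>

lemma repeat_translation:
  fixes u :: "'n::nontriv mod_ring list" and l :: "int ^ ('n mod_ring)"
  assumes u: "reduced_word u" "word_perm u = translation l" "u \<noteq> []"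
  shows inf_reduced_repeat: "inf_reduced (repeat_word u)"
    and inf_inv_repeat: "inf_inv (repeat_word u) =
      {affine_root c d | c d. c < d \<and> l $ (of_int c :: 'n mod_ring) < l $ of_int d}" (is "_ = ?S")
proof -
  let ?w = "\<lambda>k. word_perm (prefix_word k (repeat_word u))"
  have asc: "?w k c < ?w k (c + 1) \<and> l $ of_int (?w k c) < l $ of_int (?w k (c + 1))"
    if "c = to_int_mod_ring (repeat_word u k)" for k c
  proof -
    define v where "v = word_perm (take (k mod length u) u)"
    have w: "?w k b = v b + int CARD('n) * int (k div length u) * l $ of_int (v b)" for b
      using word_perm_prefix_repeat[OF u(3), of k] by (simp add: v_def u(2) translation_pow)
    have res: "(of_int (?w k b) :: 'n mod_ring) = of_int (v b)" for b
      by (simp add: w)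
    have "k mod length u < length u" using u(3) by simp
    from reduced_translation_letter[OF u(1,2) this]
    have v: "v c < v (c + 1)" and l: "l $ of_int (v c) < l $ of_int (v (c + 1))"
      using that by (simp_all add: v_def repeat_word_def)
    have "int CARD('n) * int (k div length u) * l $ of_int (v c)
        \<le> int CARD('n) * int (k div length u) * l $ of_int (v (c + 1))"
      using l by (intro mult_left_mono) simp_all
    then have "?w k c < ?w k (c + 1)" unfolding w using v by linarith
    then show ?thesis using l by (simp only: res)
  qed
  have red: "reduced_word (prefix_word k (repeat_word u))" for k
  proof (induction k)
    case 0
    show ?case by (simp add: prefix_word_def)
  next
    case (Suc k)
    have "of_int (to_int_mod_ring (repeat_word u k)) = repeat_word u k" by simp
    from reduced_word_snoc[OF this] show ?case using Suc asc by (simp add: prefix_word_Suc)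
  qed
  then show "inf_reduced (repeat_word u)" by (simp add: inf_reduced_iff)
  have "word_inv (prefix_word k (repeat_word u)) \<subseteq> ?S" for k
  proof (induction k)
    case 0
    show ?case by (simp add: prefix_word_def word_inv_def)
  next
    case (Suc k)
    have "of_int (to_int_mod_ring (repeat_word u k)) = repeat_word u k" by simp
    from word_inv_snoc[OF this, of "prefix_word k (repeat_word u)"]
    show ?case using Suc asc[OF refl, of k] by (auto simp: prefix_word_Suc)
  qed
  moreover have "affine_root c d \<in> inf_inv (repeat_word u)"
    if "c < d" and l: "l $ (of_int c :: 'n mod_ring) < l $ of_int d" for c d
  proof -
    \<comment> \<open>As \<open>l\<close> differs by at least one, \<open>m = d - c\<close> full
      copies displace \<open>c\<close> and \<open>d\<close> against each other by at least
      \<open>n * m\<close>, which exceeds the gap \<open>d - c\<close>.\<close>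
    define m where "m = nat (d - c)"
    define N where "N = int CARD('n)"
    have N: "N > 1" unfolding N_def by (rule card_gt_1)
    have w: "?w (m * length u) b = b + N * int m * l $ (of_int b :: 'n mod_ring)" for b
      using word_perm_prefix_repeat[OF u(3), of "m * length u"] u(3)
      by (simp add: u(2) translation_pow N_def)
    \<comment> \<open>\<open>?c\<close> and \<open>?d\<close> are the positions of \<open>c\<close>
      and \<open>d\<close> in this power.\<close>
    let ?c = "c - N * int m * l $ (of_int c :: 'n mod_ring)"
    let ?d = "d - N * int m * l $ (of_int d :: 'n mod_ring)"
    have "?w (m * length u) ?c = c" "?w (m * length u) ?d = d"
      by (simp_all add: w) (simp_all add: N_def)
    moreover have "?d < ?c"
    proof -
      have "N * int m * 1 \<le> N * int m * (l $ (of_int d :: 'n mod_ring) - l $ of_int c)"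
        using l N by (intro mult_left_mono) simp_all
      moreover have "d - c < N * int m"
        using that(1) N by (simp add: m_def)
      ultimately show ?thesis by (simp add: algebra_simps)
    qed
    ultimately have "affine_root c d \<in> inversions (?w (m * length u))"
      unfolding inversions_def mem_Collect_eq
      using that(1) by (intro exI[of _ ?d] exI[of _ ?c]) simp
    then show ?thesis using red word_inv_eq_inversions by (auto simp: inf_inv_def)
  qed
  ultimately show "inf_inv (repeat_word u) = ?S" by (auto simp: inf_inv_def)
qed

text \<open>Each string lies in this set or misses it. In the second case a strict inequality of
  \<open>l\<close> makes the endpoint residues distinct, so that by \<open>root_eqD\<close> the root
  determines them.\<close>

lemma lim_rel_translation:
  fixes l :: "int ^ ('n::nontriv mod_ring)"
  shows "lim_rel {affine_root c d | c d. c < d \<and> l $ (of_int c :: 'n mod_ring) < l $ of_int d}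
    = {(x, y). l $ x < l $ y}" (is "lim_rel ?S = _")
proof -
  have "infinite (root_string x y \<inter> ?S) \<longleftrightarrow> l $ x < l $ y" for x y
  proof (cases "l $ x < l $ y")
    case True
    then have "root_string x y \<inter> ?S = root_string x y" by (auto simp: root_string_def)
    then show ?thesis using True by (simp add: infinite_root_string)
  next
    case False
    have "root_string x y \<inter> ?S = {}"
    proof (rule ccontr)
      assume "root_string x y \<inter> ?S \<noteq> {}"
      then obtain r where r: "r \<in> root_string x y" "r \<in> ?S" by blast
      obtain c d where cd: "of_int c = x" "of_int d = y" "r = affine_root c d"
        using r(1) by (auto simp: root_string_def)
      obtain c' d' where l: "l $ (of_int c' :: 'n mod_ring) < l $ of_int d'"
        and eq: "affine_root c' d' = (affine_root c d :: int ^ ('n mod_ring))"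
        using r(2) unfolding cd(3) mem_Collect_eq by metis
      have ne: "(of_int c' :: 'n mod_ring) \<noteq> of_int d'" using l by auto
      obtain k where "c = c' + k * int CARD('n)" "d = d' + k * int CARD('n)"
        using root_eqD[OF eq ne] by blast
      then have "x = of_int c'" "y = of_int d'" using cd by auto
      then show False using False l by simp
    qed
    then show ?thesis using False by simp
  qed
  then show ?thesis by (simp add: lim_rel_def)
qed


section \<open>Faces and blocks\<close>

definition order_rank :: "('a \<times> 'a) set \<Rightarrow> 'a \<Rightarrow> nat" where
  "order_rank R x = card {z. (z, x) \<in> R}"

text \<open>Counting predecessors represents a strict weak order by numbers. If the count is smaller
  at \<open>x\<close>, some element is below \<open>y\<close> and not below \<open>x\<close>, and
  negative transitivity compares \<open>x\<close> with \<open>y\<close>.\<close>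

lemma order_rank_less_iff:
  fixes R :: "('a::finite \<times> 'a) set"
  assumes irrefl: "\<And>x. (x, x) \<notin> R"
    and trans: "\<And>x y z. (x, y) \<in> R \<Longrightarrow> (y, z) \<in> R \<Longrightarrow> (x, z) \<in> R"
    and neg_trans: "\<And>x y z. (x, z) \<in> R \<Longrightarrow> (x, y) \<notin> R \<Longrightarrow> (y, z) \<in> R"
  shows "order_rank R x < order_rank R y \<longleftrightarrow> (x, y) \<in> R"
proof
  assume xy: "(x, y) \<in> R"
  have "{z. (z, x) \<in> R} \<subset> {z. (z, y) \<in> R}" using xy irrefl trans by blast
  then show "order_rank R x < order_rank R y" unfolding order_rank_def by (intro psubset_card_mono) simp_all
next
  assume "order_rank R x < order_rank R y"
  then have "\<not> {z. (z, y) \<in> R} \<subseteq> {z. (z, x) \<in> R}"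
    unfolding order_rank_def by (meson card_mono finite linorder_not_le)
  then show "(x, y) \<in> R" using neg_trans by blast
qed

lemma mem_braid_face_iff: "y \<in> braid_face x \<longleftrightarrow> (\<forall>i j. y $ i < y $ j \<longleftrightarrow> x $ i < x $ j)"
proof -
  have "sgn (a - b) = sgn (c - d) \<longleftrightarrow> (a < b \<longleftrightarrow> c < d) \<and> (b < a \<longleftrightarrow> d < c)" for a b c d :: real
    by (auto simp: sgn_if)
  then show ?thesis by (auto simp: braid_face_def)
qed

text \<open>The strict part of the total preorder of a face. All points of a face agree on it, so it
  depends on no choice of a point.\<close>

definition face_rel :: "(real ^ ('n::nontriv mod_ring)) set \<Rightarrow> ('n mod_ring \<times> 'n mod_ring) set" where
  "face_rel F = {(i, j). \<forall>y\<in>F. y $ i < y $ j}"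

lemma face_rel_braid_face: "face_rel (braid_face x) = {(i, j). x $ i < x $ j}"
  by (auto simp: face_rel_def mem_braid_face_iff)

lemma braid_face_subset_closure_iff:
  "braid_face x \<subseteq> closure (braid_face y) \<longleftrightarrow> face_rel (braid_face x) \<subseteq> face_rel (braid_face y)"
proof
  assume sub: "braid_face x \<subseteq> closure (braid_face y)"
  show "face_rel (braid_face x) \<subseteq> face_rel (braid_face y)"
  proof (clarsimp simp: face_rel_braid_face, rule ccontr)
    fix i j assume less: "x $ i < x $ j" and "\<not> y $ i < y $ j"
    \<comment> \<open>This closed half-space contains the face of \<open>y\<close>, hence its
      closure, but it excludes \<open>x\<close>.\<close>
    then have "braid_face y \<subseteq> {z. z $ j \<le> z $ i}"
      by (metis (mono_tags, lifting) linorder_not_le mem_Collect_eq mem_braid_face_iff subsetI)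
    moreover have "closed {z :: real ^ 'a mod_ring. z $ j \<le> z $ i}"
      by (intro closed_Collect_le continuous_intros)
    ultimately have "closure (braid_face y) \<subseteq> {z. z $ j \<le> z $ i}" by (rule closure_minimal)
    moreover have "x \<in> braid_face x" by (simp add: mem_braid_face_iff)
    ultimately show False using sub less by force
  qed
next
  assume sub: "face_rel (braid_face x) \<subseteq> face_rel (braid_face y)"
  show "braid_face x \<subseteq> closure (braid_face y)"
  proof
    fix z assume z: "z \<in> braid_face x"
    have less_imp: "z $ i < z $ j \<Longrightarrow> y $ i < y $ j" for i j
      using z sub by (auto simp: mem_braid_face_iff face_rel_braid_face)
    \<comment> \<open>Adding a small multiple of \<open>y\<close> breaks the ties of
      \<open>z\<close> as \<open>y\<close> does, and no strict inequality of \<open>z\<close> goes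
      against \<open>y\<close>; so these points lie in the face of \<open>y\<close> and converge to
      \<open>z\<close>.\<close>
    define f where "f k = z + (1 / real (Suc k)) *\<^sub>R y" for k
    have "f k \<in> braid_face y" for k
      unfolding mem_braid_face_iff
    proof (intro allI)
      fix i j
      have less: "f k $ i < f k $ j" if "y $ i < y $ j" for i j
      proof -
        have "z $ i \<le> z $ j" using less_imp[of j i] that by (meson linorder_not_le order_less_asym)
        moreover have "(1 / real (Suc k)) * y $ i < (1 / real (Suc k)) * y $ j"
          using that by (intro mult_strict_left_mono) simp_all
        ultimately show ?thesis by (simp add: f_def)
      qed
      have eq: "f k $ i = f k $ j" if "y $ i = y $ j"
      proof -
        have "z $ i = z $ j"
          using less_imp[of i j] less_imp[of j i] that
          by (metis linorder_neqE_linordered_idom order_less_irrefl)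
        then show ?thesis using that by (simp add: f_def)
      qed
      show "f k $ i < f k $ j \<longleftrightarrow> y $ i < y $ j"
        using less[of i j] less[of j i] eq by (metis linorder_neqE_linordered_idom order_less_asym order_less_irrefl)
    qed
    moreover have "f \<longlonglongrightarrow> z + 0 *\<^sub>R y"
      unfolding f_def using LIMSEQ_inverse_real_of_nat
      by (intro tendsto_intros) (simp add: inverse_eq_divide)
    ultimately show "z \<in> closure (braid_face y)" unfolding closure_sequential by auto
  qed
qed

lemma braid_face_eq_iff: "braid_face x = braid_face y \<longleftrightarrow> face_rel (braid_face x) = face_rel (braid_face y)"
  by (auto simp: face_rel_braid_face mem_braid_face_iff set_eq_iff)

lemma minimal_face_eq: "minimal_face = braid_face 0"
proof -
  have "x \<in> minimal_face \<longleftrightarrow> (\<forall>i j. \<not> x $ i < x $ j)" for x :: "real ^ 'a mod_ring"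
    unfolding minimal_face_def mem_Collect_eq by (metis linorder_neqE_linordered_idom order_less_irrefl)
  then show ?thesis by (auto simp: mem_braid_face_iff)
qed

lemma face_rel_minimal: "face_rel minimal_face = {}"
  by (simp add: minimal_face_eq face_rel_braid_face)

lemma face_rel_inj:
  assumes "F \<in> braid_faces" "F' \<in> braid_faces" "face_rel F = face_rel F'"
  shows "F = F'"
  using assms braid_face_eq_iff by (auto simp: braid_faces_def)

lemma minimal_face_in: "minimal_face \<in> braid_faces"
  by (auto simp: braid_faces_def minimal_face_eq)

lemma face_order_eq:
  "face_order = {(F, F'). F \<in> braid_faces \<and> F' \<in> braid_faces \<and> face_rel F \<subseteq> face_rel F'}"
  using braid_face_subset_closure_iff by (auto simp: face_order_def braid_faces_def)

lemma partial_order_face_order: "partial_order_on braid_faces face_order"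
  unfolding partial_order_on_def preorder_on_def
  by (auto simp: refl_on_def trans_def antisym_def face_order_eq dest: face_rel_inj)

lemma coroot_point_less_iff:
  assumes "F \<in> braid_faces" "l \<in> coroot_points F"
  shows "l $ i < l $ j \<longleftrightarrow> (i, j) \<in> face_rel F"
  using assms by (auto simp: braid_faces_def coroot_points_def face_rel_braid_face mem_braid_face_iff)

lemma coroot_points_nonempty:
  assumes "F \<in> braid_faces"
  shows "coroot_points F \<noteq> {}"
proof -
  obtain x where F: "F = braid_face x" using assms by (auto simp: braid_faces_def)
  let ?r = "order_rank {(i, j). x $ i < x $ j}"
  have r: "?r i < ?r j \<longleftrightarrow> x $ i < x $ j" for i j
    by (subst order_rank_less_iff) auto
  \<comment> \<open>Scaling the ranks by n and subtracting their total gives integers with sum zero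
    in the same order.\<close>
  define l :: "int ^ 'a mod_ring"
    where "l = (\<chi> i. int CARD('a) * int (?r i) - (\<Sum>j\<in>UNIV. int (?r j)))"
  have "(\<Sum>i\<in>UNIV. l $ i) = 0"
    by (simp add: l_def sum_subtractf sum_distrib_left)
  moreover have "l $ i < l $ j \<longleftrightarrow> x $ i < x $ j" for i j
    using r[of i j] by (simp add: l_def)
  ultimately have "l \<in> coroot_points F"
    by (simp add: coroot_points_def F mem_braid_face_iff)
  then show ?thesis by blast
qed

section \<open>Blocks as fibres of the limit relation\<close>

lemma limit_elements_eq: "limit_elements = braid_class ` Collect inf_reduced"
  by (auto simp: limit_elements_def quotient_def braid_class_def)

lemma elt_inv_braid_class: "inf_reduced a \<Longrightarrow> elt_inv (Inr (braid_class a)) = inf_inv a"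
  by (auto simp: elt_inv_def braid_class_def braid_equiv_def)

lemma limit_eltE:
  assumes "z \<in> Inr ` limit_elements"
  obtains a where "inf_reduced a" "z = Inr (braid_class a)" "elt_inv z = inf_inv a"
  using assms elt_inv_braid_class by (auto simp: limit_elements_eq)

lemma same_block_iff:
  assumes "z \<in> Inr ` limit_elements" "z' \<in> Inr ` limit_elements"
  shows "(z, z') \<in> same_block \<longleftrightarrow> lim_rel (elt_inv z) = lim_rel (elt_inv z')"
proof -
  obtain a b where "inf_reduced a" "elt_inv z = inf_inv a" "inf_reduced b" "elt_inv z' = inf_inv b"
    using assms limit_eltE by metis
  then show ?thesis
    using assms finite_diff_iff_lim_rel[of a b] finite_diff_iff_lim_rel[of b a]
    by (auto simp: same_block_def)
qed

text \<open>By \<open>lim_rel_nonempty\<close> no limit element has the empty relation, so the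
  minimal face is free for the group block.\<close>

definition face_block :: "(real ^ ('n::nontriv mod_ring)) set \<Rightarrow> 'n elt set" where
  "face_block F = (if F = minimal_face then group_block
     else {z \<in> Inr ` limit_elements. lim_rel (elt_inv z) = face_rel F})"

lemma exists_reduced_translation:
  fixes l :: "int ^ ('n::nontriv mod_ring)"
  assumes "l \<in> coroot_points F"
  shows "\<exists>u :: 'n mod_ring list. reduced_word u \<and> word_perm u = translation l"
proof -
  have "(\<Sum>i\<in>UNIV. l $ i) = 0" using assms by (simp add: coroot_points_def)
  from exists_short_word[OF translation_affine_sym[OF this]]
  obtain u :: "'n mod_ring list" where "word_perm u = translation l"
    "length u = card (inversions (translation l) :: (int ^ ('n mod_ring)) set)" by blast
  then show ?thesis using reduced_word_iff[of u] by auto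
qed

text \<open>The third claim exhibits an inversion set that depends on \<open>F\<close> only, and
  monotonically on \<open>face_rel F\<close>; this is what \<open>block_le_iff\<close> needs to
  compare blocks.\<close>

lemma repeat_mem_face_block:
  fixes F :: "(real ^ ('n::nontriv mod_ring)) set"
  assumes F: "F \<in> braid_faces" "F \<noteq> minimal_face" and l: "l \<in> coroot_points F"
    and u: "reduced_word u" "word_perm u = translation l"
  shows "inf_reduced (repeat_word u)"
    and "Inr (braid_class (repeat_word u)) \<in> face_block F"
    and "elt_inv (Inr (braid_class (repeat_word u)))
      = {affine_root c d | c d. c < d \<and> (of_int c, of_int d) \<in> face_rel F}"
proof -
  note less = coroot_point_less_iff[OF F(1) l]
  \<comment> \<open>An empty \<open>u\<close> would give \<open>l = 0\<close>, which makes all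
    coordinates equal and \<open>F\<close> minimal.\<close>
  have "u \<noteq> []"
  proof
    assume "u = []"
    then have "translation l = id" using u(2) by simp
    then have "translation l i = i" for i by simp
    then have zero: "l $ of_int i = 0" for i by (simp add: translation_def)
    have "l $ x = 0" for x using zero[of "to_int_mod_ring x"] by simp
    then have "face_rel F = face_rel minimal_face"
      using less by (auto simp: face_rel_minimal)
    then show False using F face_rel_inj minimal_face_in by blast
  qed
  note rep = repeat_translation[OF u this]
  show red: "inf_reduced (repeat_word u)" by (rule rep)
  show inv: "elt_inv (Inr (braid_class (repeat_word u)))
      = {affine_root c d | c d. c < d \<and> (of_int c, of_int d) \<in> face_rel F}"
    unfolding elt_inv_braid_class[OF red] rep(2) by (simp only: less)
  have "lim_rel (elt_inv (Inr (braid_class (repeat_word u)))) = face_rel F"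
    unfolding elt_inv_braid_class[OF red] rep(2) lim_rel_translation using less by auto
  then show "Inr (braid_class (repeat_word u)) \<in> face_block F"
    using F red by (simp add: face_block_def limit_elements_eq)
qed

lemma face_block_point:
  fixes F :: "(real ^ ('n::nontriv mod_ring)) set"
  assumes F: "F \<in> braid_faces" "F \<noteq> minimal_face"
  obtains z where "z \<in> face_block F"
    "elt_inv z = {affine_root c d | c d. c < d \<and> (of_int c, of_int d) \<in> face_rel F}"
proof -
  obtain l where l: "l \<in> coroot_points F" using coroot_points_nonempty[OF F(1)] by blast
  obtain u :: "'n mod_ring list" where "reduced_word u" "word_perm u = translation l"
    using exists_reduced_translation[OF l] by blast
  from repeat_mem_face_block[OF F l this] show ?thesis using that by blast
qed

text \<open>The limit relation is a strict weak order, so its ranks are the coordinates of a point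
  of the face; nonemptiness keeps this face from being minimal.\<close>

lemma exists_face:
  fixes a :: "nat \<Rightarrow> 'n::nontriv mod_ring"
  assumes a: "inf_reduced a"
  obtains F where "F \<in> braid_faces" "F \<noteq> minimal_face" "face_rel F = lim_rel (inf_inv a)"
proof -
  define R where "R = lim_rel (inf_inv a)"
  define x :: "real ^ 'n mod_ring" where "x = (\<chi> i. real (order_rank R i))"
  have "order_rank R i < order_rank R j \<longleftrightarrow> (i, j) \<in> R" for i j
    unfolding R_def
    by (rule order_rank_less_iff) (fact lim_rel_irrefl[OF a], fact lim_rel_trans[OF a], fact lim_rel_neg_trans[OF a])
  then have rel: "face_rel (braid_face x) = R" by (simp add: face_rel_braid_face x_def)
  moreover have "braid_face x \<noteq> minimal_face"
    using rel face_rel_minimal lim_rel_nonempty[OF a] unfolding R_def by metis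
  ultimately show ?thesis using that unfolding R_def braid_faces_def by blast
qed

lemma blocks_eq: "blocks = face_block ` (braid_faces :: (real ^ ('n::nontriv mod_ring)) set set)"
proof (intro equalityI subsetI)
  fix B :: "'n elt set" assume "B \<in> blocks"
  then consider "B = group_block" | "B \<in> (Inr ` limit_elements) // same_block"
    by (auto simp: blocks_def)
  then show "B \<in> face_block ` braid_faces"
  proof cases
    case 1
    then show ?thesis using minimal_face_in by (force simp: face_block_def)
  next
    case 2
    then obtain z where B: "B = same_block `` {z}" and z: "z \<in> Inr ` limit_elements"
      by (rule quotientE)
    obtain a where a: "inf_reduced a" "elt_inv z = inf_inv a" using limit_eltE[OF z] by metis
    obtain F :: "(real ^ ('n mod_ring)) set"
      where F: "F \<in> braid_faces" "F \<noteq> minimal_face" "face_rel F = lim_rel (inf_inv a)"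
      using exists_face[OF a(1)] .
    have "z' \<in> B \<longleftrightarrow> z' \<in> face_block F" for z'
      using same_block_iff[OF z, of z'] F a(2) by (auto simp: B face_block_def same_block_def)
    then have "B = face_block F" by blast
    then show ?thesis using F by blast
  qed
next
  fix B :: "'n elt set" assume "B \<in> face_block ` braid_faces"
  then obtain F where F: "F \<in> braid_faces" "B = face_block F" by blast
  show "B \<in> blocks"
  proof (cases "F = minimal_face")
    case True
    then show ?thesis using F by (simp add: face_block_def blocks_def)
  next
    case False
    \<comment> \<open>A fibre of the relation is an equivalence class only once it is
      inhabited.\<close>
    obtain z where z: "z \<in> B" using face_block_point[OF F(1) False] F(2) by metis
    then have lim: "z \<in> Inr ` limit_elements" "lim_rel (elt_inv z) = face_rel F"
      using False F(2) by (auto simp: face_block_def)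
    have "z' \<in> B \<longleftrightarrow> z' \<in> same_block `` {z}" for z'
      using same_block_iff[OF lim(1), of z'] lim(2) F(2) False
      by (auto simp: face_block_def same_block_def)
    then have "B = same_block `` {z}" by blast
    then show ?thesis using lim(1) by (auto simp: blocks_def quotient_def)
  qed
qed

section \<open>Comparison of blocks\<close>

lemma finite_perm_inv: "finite (perm_inv w :: (int ^ ('n::nontriv mod_ring)) set)"
proof -
  \<comment> \<open>Reduced words of \<open>w\<close> share one length over a finite alphabet, so
    the union in \<open>perm_inv\<close> is finite.\<close>
  have "{u :: 'n mod_ring list. reduced_word u \<and> word_perm u = w}
      \<subseteq> {u. set u \<subseteq> UNIV \<and> length u = affine_length TYPE('n) w}"
    by (auto simp: reduced_word_def)
  then have "finite {u :: 'n mod_ring list. reduced_word u \<and> word_perm u = w}"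
    by (rule finite_subset) (rule finite_lists_length_eq[OF finite])
  then show ?thesis unfolding perm_inv_def word_inv_def by simp
qed

lemma perm_inv_id: "perm_inv id = ({} :: (int ^ ('n::nontriv mod_ring)) set)"
proof -
  have "u = []" if "reduced_word u" "word_perm u = id" for u :: "'n mod_ring list"
    using that by (simp add: reduced_word_iff inversions_id)
  then have "{u :: 'n mod_ring list. reduced_word u \<and> word_perm u = id} \<subseteq> {[]}" by blast
  then show ?thesis unfolding perm_inv_def by (force simp: word_inv_def)
qed

text \<open>The group block lies below everything through \<open>id\<close>, and no infinite
  inversion set fits into one of its finite ones. Between the other blocks, an inclusion of
  inversion sets passes to the relations by \<open>lim_rel_mono\<close>, and the representatives
  from \<open>face_block_point\<close> give the converse.\<close>

lemma block_le_iff: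
  fixes F F' :: "(real ^ ('n::nontriv mod_ring)) set"
  assumes F: "F \<in> braid_faces" and F': "F' \<in> braid_faces"
  shows "(\<exists>x\<in>face_block F. \<exists>y\<in>face_block F'. elt_le x y) \<longleftrightarrow> face_rel F \<subseteq> face_rel F'"
proof -
  have group: "Inl id \<in> face_block (minimal_face :: (real ^ ('n mod_ring)) set)"
    using word_perm_affine_sym[of "[] :: 'n mod_ring list"] by (simp add: face_block_def group_block_def)
  have bot: "elt_le (Inl id) z" for z :: "'n elt"
    by (simp add: elt_le_def elt_inv_def perm_inv_id)
  show ?thesis
  proof (cases "F = minimal_face")
    case True
    obtain z where "z \<in> face_block F'"
      using group face_block_point[OF F'] by metis
    then show ?thesis using True group bot by (auto simp: face_rel_minimal)
  next
    case nonmin: False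
    obtain z where z: "z \<in> face_block F"
      "elt_inv z = {affine_root c d | c d. c < d \<and> (of_int c, of_int d) \<in> face_rel F}"
      using face_block_point[OF F nonmin] .
    show ?thesis
    proof (cases "F' = minimal_face")
      case True
      have "\<not> elt_le x y" if "x \<in> face_block F" "y \<in> face_block F'" for x y
      proof
        assume "elt_le x y"
        have "x \<in> Inr ` limit_elements" using that(1) nonmin by (simp add: face_block_def)
        then obtain a where a: "inf_reduced a" "elt_inv x = inf_inv a" by (rule limit_eltE)
        moreover have "finite (elt_inv y)"
          using that(2) True by (auto simp: face_block_def group_block_def elt_inv_def finite_perm_inv)
        ultimately show False
          using \<open>elt_le x y\<close> infinite_inf_inv[OF a(1)] finite_subset by (auto simp: elt_le_def)
      qed
      moreover have "\<not> face_rel F \<subseteq> face_rel F'"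
        using True nonmin F F' face_rel_inj[OF F minimal_face_in] by (auto simp: face_rel_minimal)
      ultimately show ?thesis by blast
    next
      case False
      obtain z' where z': "z' \<in> face_block F'"
        "elt_inv z' = {affine_root c d | c d. c < d \<and> (of_int c, of_int d) \<in> face_rel F'}"
        using face_block_point[OF F' False] .
      have "face_rel F \<subseteq> face_rel F'" if "x \<in> face_block F" "y \<in> face_block F'" "elt_le x y" for x y
        using that nonmin False lim_rel_mono[of "elt_inv x" "elt_inv y"]
        by (auto simp: face_block_def elt_le_def)
      moreover have "elt_le z z'" if "face_rel F \<subseteq> face_rel F'"
        using that z(2) z'(2) by (auto simp: elt_le_def)
      ultimately show ?thesis using z(1) z'(1) by blast
    qed
  qed
qed

text \<open>Every block is comparable with itself, so equal blocks give both inclusions of the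
  relations.\<close>

lemma face_block_inj: "inj_on face_block (braid_faces :: (real ^ ('n::nontriv mod_ring)) set set)"
proof (rule inj_onI)
  fix F F' :: "(real ^ ('n mod_ring)) set"
  assume F: "F \<in> braid_faces" and F': "F' \<in> braid_faces" and eq: "face_block F = face_block F'"
  have refl: "\<exists>x\<in>face_block G. \<exists>y\<in>face_block G. elt_le x y" if "G \<in> braid_faces" for G
    using block_le_iff[OF that that] by blast
  have "face_rel F = face_rel F'"
    using block_le_iff[OF F F'] block_le_iff[OF F' F] refl[OF F] eq by auto
  then show "F = F'" by (rule face_rel_inj[OF F F'])
qed

text \<open>Pulls the order axioms of the target back along the bijection; transitivity and
  antisymmetry of \<open>block_order\<close> are not evident from its existential
  definition.\<close>

lemma poset_isomorphism_transfer:
  assumes "partial_order_on A r" "bij_betw f A B" "s \<subseteq> B \<times> B"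
    and iff: "\<And>x y. x \<in> A \<Longrightarrow> y \<in> A \<Longrightarrow> (x, y) \<in> r \<longleftrightarrow> (f x, f y) \<in> s"
  shows "poset_isomorphism A r B s f"
proof -
  have B: "B = f ` A" and inj: "inj_on f A" using assms(2) by (auto simp: bij_betw_def)
  have r: "refl_on A r" "trans r" "antisym r"
    using assms(1) by (auto simp: partial_order_on_def preorder_on_def)
  have "refl_on B s" using r(1) iff by (auto simp: refl_on_def B)
  moreover have "trans s"
  proof (rule transI)
    fix x y z assume s: "(x, y) \<in> s" "(y, z) \<in> s"
    then have "x \<in> B" "y \<in> B" "z \<in> B" using assms(3) by auto
    then obtain x' y' z' where "x = f x'" "y = f y'" "z = f z'" "x' \<in> A" "y' \<in> A" "z' \<in> A"
      unfolding B by blast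
    then show "(x, z) \<in> s" using s iff transD[OF r(2), of x' y' z'] by metis
  qed
  moreover have "antisym s"
  proof (rule antisymI)
    fix x y assume s: "(x, y) \<in> s" "(y, x) \<in> s"
    then have "x \<in> B" "y \<in> B" using assms(3) by auto
    then obtain x' y' where "x = f x'" "y = f y'" "x' \<in> A" "y' \<in> A" unfolding B by blast
    then show "x = y" using s iff antisymD[OF r(3), of x' y'] by metis
  qed
  ultimately show ?thesis
    using assms by (simp add: poset_isomorphism_def partial_order_on_def preorder_on_def)
qed

theorem theorem4p14:
  shows "\<exists>\<Phi> :: (real ^ ('n::nontriv mod_ring)) set \<Rightarrow> 'n elt set.
    \<Phi> minimal_face = group_block \<and>
    (\<forall>F \<in> braid_faces - {minimal_face}.
       coroot_points F \<noteq> {} \<and>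
       (\<forall>l \<in> coroot_points F.
          (\<exists>u :: 'n mod_ring list. reduced_word u \<and> word_perm u = translation l) \<and>
          (\<forall>u :: 'n mod_ring list. reduced_word u \<and> word_perm u = translation l \<longrightarrow>
             inf_reduced (repeat_word u) \<and> Inr (braid_class (repeat_word u)) \<in> \<Phi> F))) \<and>
    poset_isomorphism braid_faces face_order blocks block_order \<Phi>"
proof (intro exI[of _ face_block] conjI ballI allI impI)
  show "face_block minimal_face = (group_block :: 'n elt set)" by (simp add: face_block_def)
next
  fix F :: "(real ^ ('n mod_ring)) set" assume "F \<in> braid_faces - {minimal_face}"
  then have F: "F \<in> braid_faces" "F \<noteq> minimal_face" by auto
  show "coroot_points F \<noteq> {}" by (rule coroot_points_nonempty[OF F(1)])
  fix l assume l: "l \<in> coroot_points F"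
  show "\<exists>u :: 'n mod_ring list. reduced_word u \<and> word_perm u = translation l"
    by (rule exists_reduced_translation[OF l])
  fix u :: "'n mod_ring list" assume "reduced_word u \<and> word_perm u = translation l"
  then show "inf_reduced (repeat_word u)" "Inr (braid_class (repeat_word u)) \<in> face_block F"
    using repeat_mem_face_block[OF F l] by blast+
next
  show "poset_isomorphism braid_faces face_order blocks block_order
      (face_block :: (real ^ ('n mod_ring)) set \<Rightarrow> 'n elt set)"
  proof (rule poset_isomorphism_transfer)
    show "partial_order_on braid_faces face_order" by (rule partial_order_face_order)
    show "bij_betw face_block (braid_faces :: (real ^ ('n mod_ring)) set set) blocks"
      using face_block_inj by (simp add: bij_betw_def blocks_eq)
    show "block_order \<subseteq> blocks \<times> (blocks :: 'n elt set set)" by (auto simp: block_order_def)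
    show "(F, F') \<in> face_order \<longleftrightarrow> (face_block F, face_block F') \<in> block_order"
      if "F \<in> braid_faces" "F' \<in> braid_faces" for F F' :: "(real ^ ('n mod_ring)) set"
      using that block_le_iff[OF that] by (simp add: face_order_eq block_order_def blocks_eq)
  qed
qed

end
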